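(* Let $\left((F,\nu,N),[\,,]_{F,h},(\rho,\eta)\right)$ be a generalized Lie algebroid with exterior differentiation operator $d^F$. Then: 1. For any $\omega\in\Lambda^q(F,\nu,N)$ and $\theta\in\Lambda^r(F,\nu,N)$, $\;d^F(\omega\wedge\theta)=d^F\omega\wedge\theta+(-1)^q\,\omega\wedge d^F\theta$. 2. For any $z\in\Gamma(F,\nu,N)$, $\;L_z\circ d^F=d^F\circ L_z$. 3. $d^F\circ d^F=0$.
   Context: All manifolds, maps, bundles and sections are smooth; $\mathcal F(N)=C^\infty(N,\mathbb R)$; $\Gamma(F,\nu,N)$ is the $\mathcal F(N)$-module of sections of a vector bundle $(F,\nu,N)$. For a vector bundle morphism $(\varphi,\varphi_0)$ from $(E,\pi,M)$ to $(E',\pi',M')$ with $\varphi_0:M\to M'$ a diffeomorphism, $\Gamma(\varphi,\varphi_0):\Gamma(E,\pi,M)\to\Gamma(E',\pi',M')$ is defined by $(\Gamma(\varphi,\varphi_0)u)(y)=\varphi(u(\varphi_0^{-1}(y)))$. Generalized Lie algebroid: let $h:M\to N$ and $\eta:N\to M$ be diffeomorphisms, $(F,\nu,N)$ a vector bundle, $(\rho,\eta)$ a vector bundle morphism from $(F,\nu,N)$ to $(TM,\tau_M,M)$, and $[\,,]_{F,h}:\Gamma(F,\nu,N)\times\Gamma(F,\nu,N)\to\Gamma(F,\nu,N)$ an operation. Write $a(z)=\Gamma(Th\circ\rho,h\circ\eta)(z)$, a vector field on $N$, for $z\in\Gamma(F,\nu,N)$. The triple $((F,\nu,N),[\,,]_{F,h},(\rho,\eta))$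 is a generalized Lie algebroid if: (1) $[u,fv]_{F,h}=f[u,v]_{F,h}+(a(u)f)\,v$ for all $u,v\in\Gamma(F,\nu,N)$, $f\in\mathcal F(N)$; (2) $(\Gamma(F,\nu,N),[\,,]_{F,h})$ is a real Lie algebra; (3) $a:\Gamma(F,\nu,N)\to\Gamma(TN,\tau_N,N)$ is a morphism of Lie algebras (for the usual bracket of vector fields). Forms: $\Lambda^0(F,\nu,N)=\mathcal F(N)$ and, for $q\ge1$, $\Lambda^q(F,\nu,N)$ is the set of alternating $\mathcal F(N)$-multilinear maps $\Gamma(F,\nu,N)^q\to\mathcal F(N)$. The exterior product of $\omega\in\Lambda^q$ and $\theta\in\Lambda^r$ is $$(\omega\wedge\theta)(z_1,\dots,z_{q+r})=\sum_{\sigma}\operatorname{sgn}(\sigma)\,\omega(z_{\sigma(1)},\dots,z_{\sigma(q)})\,\theta(z_{\sigma(q+1)},\dots,z_{\sigma(q+r)}),$$ the sum over permutations $\sigma$ of $\{1,\dots,q+r\}$ with $\sigma(1)<\dots<\sigma(q)$ and $\sigma(q+1)<\dots<\sigma(q+r)$. Covariant Lie derivative with respect to $z$: $L_zf=a(z)f$ for $f\in\mathcal F(N)$, and for $\omega\in\Lambda^q(F,\nu,N)$ $$(L_z\omega)(z_1,\dots,z_q)=a(z)\big(\omega(z_1,\dots,z_q)\big)-\sum_{i=1}^q\omega(z_1,\dots,[z,z_i]_{F,h},\dots,z_q).$$ Exterior differentiation operator $d^F:\Lambda^q(F,\nu,N)\to\Lambda^{q+1}(F,\nu,N)$: $d^Ff(z)=a(z)f$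 for $f\in\mathcal F(N)$, and $$d^F\omega(z_0,\dots,z_q)=\sum_{i=0}^q(-1)^i a(z_i)\big(\omega(z_0,\dots,\hat z_i,\dots,z_q)\big)+\sum_{i<j}(-1)^{i+j}\omega\big([z_i,z_j]_{F,h},z_0,\dots,\hat z_i,\dots,\hat z_j,\dots,z_q\big),$$ where a hat denotes omission. *)

theory Defs
  imports "HOL-Analysis.Analysis" "HOL-Combinatorics.Permutations"
begin

section \<open>Smooth maps between open sets of normed spaces\<close>

text \<open>
  These notions are used for open sets of finite-dimensional spaces only, where continuity of all
  iterated directional derivatives is the usual notion of smoothness.
\<close>

primrec Ck_on :: "nat \<Rightarrow> 'a::real_normed_vector set \<Rightarrow> ('a \<Rightarrow> 'b::real_normed_vector) \<Rightarrow> bool" where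
  "Ck_on 0 S f \<longleftrightarrow> continuous_on S f"
| "Ck_on (Suc k) S f \<longleftrightarrow> (\<forall>x\<in>S. f differentiable (at x)) \<and>
     (\<forall>v. Ck_on k S (\<lambda>x. frechet_derivative f (at x) v))"

definition smooth_on :: "'a::real_normed_vector set \<Rightarrow> ('a \<Rightarrow> 'b::real_normed_vector) \<Rightarrow> bool" where
  "smooth_on S f \<longleftrightarrow> (\<forall>k. Ck_on k S f)"

section \<open>Smooth manifolds\<close>

text \<open>
  A manifold is given by an atlas, i.e. a set of charts (domain, coordinate map) with values in a
  finite-dimensional real inner product space. (The class \<open>euclidean_space\<close> is not used
  because it excludes dimension 0, and with it Lie algebras as Lie algebroids over a point.)
  The points of the manifold are those covered by a chart; coordinate maps are relevant only on
  their domains.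
\<close>

type_synonym ('a, 'e) chart = "'a set \<times> ('a \<Rightarrow> 'e)"
type_synonym ('a, 'e) atlas = "('a, 'e) chart set"

definition points :: "('a, 'e) atlas \<Rightarrow> 'a set" where
  "points A = (\<Union>(U, \<phi>)\<in>A. U)"

definition atlas_topology :: "('a, 'e::real_inner) atlas \<Rightarrow> 'a topology" where
  "atlas_topology A = topology (\<lambda>W. W \<subseteq> points A \<and> (\<forall>(U, \<phi>)\<in>A. open (\<phi> ` (W \<inter> U))))"

lemma openin_atlas_topology:
  assumes "\<And>U \<phi>. (U, \<phi>) \<in> A \<Longrightarrow> inj_on \<phi> U"
  shows "openin (atlas_topology A) W \<longleftrightarrow>
    W \<subseteq> points A \<and> (\<forall>(U, \<phi>)\<in>A. open (\<phi> ` (W \<inter> U)))"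
proof -
  have inter: "\<phi> ` (S \<inter> T \<inter> U) = \<phi> ` (S \<inter> U) \<inter> \<phi> ` (T \<inter> U)" if "(U, \<phi>) \<in> A" for S T U \<phi>
    using assms[OF that] by (auto simp: inj_on_def)
  have union: "\<phi> ` (\<Union>K \<inter> U) = (\<Union>S\<in>K. \<phi> ` (S \<inter> U))" for K U and \<phi> :: "'a \<Rightarrow> 'b"
    by auto
  have "istopology (\<lambda>W. W \<subseteq> points A \<and> (\<forall>(U, \<phi>)\<in>A. open (\<phi> ` (W \<inter> U))))"
    unfolding istopology_def
  proof (intro conjI allI impI)
    fix S T
    assume S: "S \<subseteq> points A \<and> (\<forall>(U, \<phi>)\<in>A. open (\<phi> ` (S \<inter> U)))"
       and T: "T \<subseteq> points A \<and> (\<forall>(U, \<phi>)\<in>A. open (\<phi> ` (T \<inter> U)))"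
    show "S \<inter> T \<subseteq> points A" using S by auto
    show "\<forall>(U, \<phi>)\<in>A. open (\<phi> ` (S \<inter> T \<inter> U))"
      using S T inter by (fastforce intro: open_Int)
  next
    fix K
    assume K: "\<forall>S\<in>K. S \<subseteq> points A \<and> (\<forall>(U, \<phi>)\<in>A. open (\<phi> ` (S \<inter> U)))"
    show "\<Union>K \<subseteq> points A" using K by auto
    show "\<forall>(U, \<phi>)\<in>A. open (\<phi> ` (\<Union>K \<inter> U))"
      unfolding union using K by (fastforce intro: open_UN)
  qed
  then show ?thesis
    unfolding atlas_topology_def by (simp add: topology_inverse')
qed

definition smooth_manifold :: "('a, 'e::real_inner) atlas \<Rightarrow> bool" where
  "smooth_manifold A \<longleftrightarrow>
     (\<exists>B::'e set. finite B \<and> span B = UNIV) \<and>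
     (\<forall>(U, \<phi>)\<in>A. inj_on \<phi> U \<and> open (\<phi> ` U)) \<and>
     (\<forall>(U, \<phi>)\<in>A. \<forall>(V, \<psi>)\<in>A. open (\<phi> ` (U \<inter> V)) \<and>
        smooth_on (\<phi> ` (U \<inter> V)) (\<psi> \<circ> inv_into U \<phi>)) \<and>
     Hausdorff_space (atlas_topology A) \<and> second_countable (atlas_topology A)"

text \<open>A normed space as a manifold, open submanifolds, and products.\<close>

definition space_atlas :: "('e, 'e) atlas" where
  "space_atlas = {(UNIV, \<lambda>x. x)}"

definition open_sub :: "('a, 'e) atlas \<Rightarrow> 'a set \<Rightarrow> ('a, 'e) atlas" where
  "open_sub A W = (\<lambda>(U, \<phi>). (U \<inter> W, \<phi>)) ` A"

definition product_atlas :: "('a, 'e) atlas \<Rightarrow> ('b, 'd) atlas \<Rightarrow> ('a \<times> 'b, 'e \<times> 'd) atlas" where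
  "product_atlas A B = {(U \<times> V, map_prod \<phi> \<psi>) | U \<phi> V \<psi>. (U, \<phi>) \<in> A \<and> (V, \<psi>) \<in> B}"

definition smooth_map ::
  "('a, 'e::real_inner) atlas \<Rightarrow> ('b, 'd::real_inner) atlas \<Rightarrow> ('a \<Rightarrow> 'b) \<Rightarrow> bool" where
  "smooth_map A B f \<longleftrightarrow>
     continuous_map (atlas_topology A) (atlas_topology B) f \<and>
     (\<forall>(U, \<phi>)\<in>A. \<forall>(V, \<psi>)\<in>B.
        smooth_on (\<phi> ` (U \<inter> f -` V)) (\<psi> \<circ> f \<circ> inv_into U \<phi>))"

definition diffeomorphism ::
  "('a, 'e::real_inner) atlas \<Rightarrow> ('b, 'd::real_inner) atlas \<Rightarrow> ('a \<Rightarrow> 'b) \<Rightarrow> bool" where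
  "diffeomorphism A B f \<longleftrightarrow> bij_betw f (points A) (points B) \<and>
     smooth_map A B f \<and> smooth_map B A (inv_into (points A) f)"

text \<open>
  The ring of smooth functions. Functions on a manifold are represented by functions on the ambient
  type vanishing outside the set of points, so that the ring operations are pointwise.
\<close>

definition smooth_functions :: "('a, 'e::real_inner) atlas \<Rightarrow> ('a \<Rightarrow> real) set" where
  "smooth_functions A = {f. smooth_map A space_atlas f \<and> (\<forall>p. p \<notin> points A \<longrightarrow> f p = 0)}"

definition smooth_at :: "('a, 'e::real_inner) atlas \<Rightarrow> 'a \<Rightarrow> ('a \<Rightarrow> real) \<Rightarrow> bool" where
  "smooth_at A p f \<longleftrightarrow>
     (\<exists>W. openin (atlas_topology A) W \<and> p \<in> W \<and> smooth_map (open_sub A W) space_atlas f)"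

section \<open>Tangent vectors\<close>

text \<open>
  The velocity of a curve \<open>\<gamma>\<close> at time 0 is the derivation
  \<open>f \<mapsto> (f \<circ> \<gamma>)'(0)\<close> on functions smooth near \<open>\<gamma> 0\<close>, extended by 0
  to all other functions; the tangent vectors at \<open>p\<close> are the velocities of smooth curves
  through \<open>p\<close>. Addition and scaling of tangent vectors are therefore pointwise.
\<close>

type_synonym 'a tangent_vector = "('a \<Rightarrow> real) \<Rightarrow> real"

definition velocity :: "('a, 'e::real_inner) atlas \<Rightarrow> (real \<Rightarrow> 'a) \<Rightarrow> 'a tangent_vector" where
  "velocity A \<gamma> = (\<lambda>f. if smooth_at A (\<gamma> 0) f then deriv (\<lambda>t. f (\<gamma> t)) 0 else 0)"

definition tangent_space :: "('a, 'e::real_inner) atlas \<Rightarrow> 'a \<Rightarrow> 'a tangent_vector set" where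
  "tangent_space A p = {velocity A \<gamma> | \<gamma> \<epsilon>.
     \<epsilon> > 0 \<and> smooth_map (open_sub space_atlas {-\<epsilon><..<\<epsilon>}) A \<gamma> \<and> \<gamma> 0 = p}"

text \<open>
  A chart \<open>\<phi>\<close> of \<open>A\<close> induces the chart
  \<open>(p, v) \<mapsto> (\<phi> p, w)\<close>, where \<open>w\<close> is the coordinate
  vector of \<open>v\<close>: applied to each linear coordinate of \<open>\<phi>\<close>, the derivation
  \<open>v\<close> yields the same coordinate of \<open>w\<close>.
\<close>

definition tangent_atlas ::
  "('a, 'e::real_inner) atlas \<Rightarrow> ('a \<times> 'a tangent_vector, 'e \<times> 'e) atlas" where
  "tangent_atlas A =
     (\<lambda>(U, \<phi>). (Sigma U (tangent_space A),
        \<lambda>(p, v). (\<phi> p, THE w. \<forall>b. v (\<lambda>q. \<phi> q \<bullet> b) = w \<bullet> b))) ` A"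

definition tangent_map ::
  "('b, 'd::real_inner) atlas \<Rightarrow> ('a \<Rightarrow> 'b) \<Rightarrow> 'a \<times> 'a tangent_vector \<Rightarrow> 'b \<times> 'b tangent_vector" where
  "tangent_map B h = (\<lambda>(p, v). (h p, \<lambda>f. if smooth_at B (h p) f then v (f \<circ> h) else 0))"

section \<open>Vector bundles\<close>

record ('f, 'n, 'e, 'k) vbundle =
  total :: "('f, 'e \<times> 'k) atlas"
  base :: "('n, 'e) atlas"
  proj :: "'f \<Rightarrow> 'n"
  fadd :: "'f \<Rightarrow> 'f \<Rightarrow> 'f"
  fzero :: "'n \<Rightarrow> 'f"
  fscale :: "real \<Rightarrow> 'f \<Rightarrow> 'f"

definition fibre :: "('f, 'n, 'e, 'k) vbundle \<Rightarrow> 'n \<Rightarrow> 'f set" where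
  "fibre E p = {e \<in> points (total E). proj E e = p}"

text \<open>
  The vector space axioms for the fibres are not listed because they follow from the existence of
  fibrewise linear bijections onto the model fibre.
\<close>

definition local_trivialization ::
  "('f, 'n, 'e::real_inner, 'k::real_inner) vbundle \<Rightarrow> 'n set \<Rightarrow> ('f \<Rightarrow> 'k) \<Rightarrow> bool" where
  "local_trivialization E W \<Phi> \<longleftrightarrow>
     diffeomorphism (open_sub (total E) (proj E -` W))
       (product_atlas (open_sub (base E) W) space_atlas) (\<lambda>e. (proj E e, \<Phi> e)) \<and>
     (\<forall>q\<in>W. \<Phi> (fzero E q) = 0 \<and>
        (\<forall>x\<in>fibre E q. (\<forall>y\<in>fibre E q. \<Phi> (fadd E x y) = \<Phi> x + \<Phi> y) \<and>
           (\<forall>c. \<Phi> (fscale E c x) = c *\<^sub>R \<Phi> x)))"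

definition vector_bundle :: "('f, 'n, 'e::real_inner, 'k::real_inner) vbundle \<Rightarrow> bool" where
  "vector_bundle E \<longleftrightarrow>
     smooth_manifold (total E) \<and> smooth_manifold (base E) \<and>
     smooth_map (total E) (base E) (proj E) \<and>
     (\<forall>p\<in>points (base E). fzero E p \<in> fibre E p \<and>
        (\<forall>x\<in>fibre E p. (\<forall>y\<in>fibre E p. fadd E x y \<in> fibre E p) \<and>
           (\<forall>c. fscale E c x \<in> fibre E p))) \<and>
     (\<forall>p\<in>points (base E). \<exists>W \<Phi>. openin (atlas_topology (base E)) W \<and> p \<in> W \<and>
        local_trivialization E W \<Phi>)"

definition tangent_bundle ::
  "('a, 'e::real_inner) atlas \<Rightarrow> ('a \<times> 'a tangent_vector, 'a, 'e, 'e) vbundle" where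
  "tangent_bundle A = \<lparr>
     total = tangent_atlas A,
     base = A,
     proj = fst,
     fadd = (\<lambda>(p, v) (q, w). (p, \<lambda>f. v f + w f)),
     fzero = (\<lambda>p. (p, \<lambda>f. 0)),
     fscale = (\<lambda>c (p, v). (p, \<lambda>f. c * v f)) \<rparr>"

definition vector_bundle_morphism ::
  "('f, 'n, 'e::real_inner, 'k::real_inner) vbundle \<Rightarrow>
   ('g, 'm, 'd::real_inner, 'l::real_inner) vbundle \<Rightarrow> ('f \<Rightarrow> 'g) \<Rightarrow> ('n \<Rightarrow> 'm) \<Rightarrow> bool" where
  "vector_bundle_morphism E E' \<phi> \<phi>0 \<longleftrightarrow>
     smooth_map (total E) (total E') \<phi> \<and> smooth_map (base E) (base E') \<phi>0 \<and>
     (\<forall>x\<in>points (total E). proj E' (\<phi> x) = \<phi>0 (proj E x)) \<and>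
     (\<forall>p\<in>points (base E). \<forall>x\<in>fibre E p.
        (\<forall>y\<in>fibre E p. \<phi> (fadd E x y) = fadd E' (\<phi> x) (\<phi> y)) \<and>
        (\<forall>c. \<phi> (fscale E c x) = fscale E' c (\<phi> x)))"

definition sections :: "('f, 'n, 'e::real_inner, 'k::real_inner) vbundle \<Rightarrow> ('n \<Rightarrow> 'f) set" where
  "sections E = {s \<in> extensional (points (base E)). smooth_map (base E) (total E) s \<and>
     (\<forall>p\<in>points (base E). proj E (s p) = p)}"

definition sec_add :: "('f, 'n, 'e, 'k) vbundle \<Rightarrow> ('n \<Rightarrow> 'f) \<Rightarrow> ('n \<Rightarrow> 'f) \<Rightarrow> 'n \<Rightarrow> 'f" where
  "sec_add E u v = (\<lambda>p\<in>points (base E). fadd E (u p) (v p))"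

definition sec_zero :: "('f, 'n, 'e, 'k) vbundle \<Rightarrow> 'n \<Rightarrow> 'f" where
  "sec_zero E = (\<lambda>p\<in>points (base E). fzero E p)"

definition sec_scale :: "('f, 'n, 'e, 'k) vbundle \<Rightarrow> ('n \<Rightarrow> real) \<Rightarrow> ('n \<Rightarrow> 'f) \<Rightarrow> 'n \<Rightarrow> 'f" where
  "sec_scale E f u = (\<lambda>p\<in>points (base E). fscale E (f p) (u p))"

text \<open>The map \<open>\<Gamma>(\<phi>, \<phi>\<^sub>0)\<close> induced on sections by a morphism over a
  diffeomorphism.\<close>

definition sec_map ::
  "('f, 'n, 'e, 'k) vbundle \<Rightarrow> ('g, 'm, 'd, 'l) vbundle \<Rightarrow> ('f \<Rightarrow> 'g) \<Rightarrow> ('n \<Rightarrow> 'm) \<Rightarrow>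
   ('n \<Rightarrow> 'f) \<Rightarrow> 'm \<Rightarrow> 'g" where
  "sec_map E E' \<phi> \<phi>0 u =
     (\<lambda>y\<in>points (base E'). \<phi> (u (inv_into (points (base E)) \<phi>0 y)))"

section \<open>Vector fields\<close>

definition vf_act ::
  "('a, 'e) atlas \<Rightarrow> ('a \<Rightarrow> 'a \<times> 'a tangent_vector) \<Rightarrow> ('a \<Rightarrow> real) \<Rightarrow> 'a \<Rightarrow> real" where
  "vf_act A X f = (\<lambda>p. if p \<in> points A then snd (X p) f else 0)"

definition vf_bracket ::
  "('a, 'e::real_inner) atlas \<Rightarrow> ('a \<Rightarrow> 'a \<times> 'a tangent_vector) \<Rightarrow>
   ('a \<Rightarrow> 'a \<times> 'a tangent_vector) \<Rightarrow> 'a \<Rightarrow> 'a \<times> 'a tangent_vector" where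
  "vf_bracket A X Y = (\<lambda>p\<in>points A. (p, \<lambda>f. if smooth_at A p f
     then snd (X p) (vf_act A Y f) - snd (Y p) (vf_act A X f) else 0))"

section \<open>Real Lie algebras\<close>

record 'v lie_algebra =
  lcarrier :: "'v set"
  ladd :: "'v \<Rightarrow> 'v \<Rightarrow> 'v"
  lzero :: 'v
  lscale :: "real \<Rightarrow> 'v \<Rightarrow> 'v"
  lbracket :: "'v \<Rightarrow> 'v \<Rightarrow> 'v"

locale real_lie_algebra =
  fixes L :: "'v lie_algebra"
  assumes add_closed: "\<lbrakk>u \<in> lcarrier L; v \<in> lcarrier L\<rbrakk> \<Longrightarrow> ladd L u v \<in> lcarrier L"
    and zero_closed: "lzero L \<in> lcarrier L"
    and scale_closed: "u \<in> lcarrier L \<Longrightarrow> lscale L c u \<in> lcarrier L"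
    and bracket_closed: "\<lbrakk>u \<in> lcarrier L; v \<in> lcarrier L\<rbrakk> \<Longrightarrow> lbracket L u v \<in> lcarrier L"
    and add_assoc: "\<lbrakk>u \<in> lcarrier L; v \<in> lcarrier L; w \<in> lcarrier L\<rbrakk> \<Longrightarrow>
      ladd L (ladd L u v) w = ladd L u (ladd L v w)"
    and add_commute: "\<lbrakk>u \<in> lcarrier L; v \<in> lcarrier L\<rbrakk> \<Longrightarrow> ladd L u v = ladd L v u"
    and add_zero: "u \<in> lcarrier L \<Longrightarrow> ladd L u (lzero L) = u"
    and add_inverse: "u \<in> lcarrier L \<Longrightarrow> \<exists>v\<in>lcarrier L. ladd L u v = lzero L"
    and scale_add_right: "\<lbrakk>u \<in> lcarrier L; v \<in> lcarrier L\<rbrakk> \<Longrightarrow>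
      lscale L c (ladd L u v) = ladd L (lscale L c u) (lscale L c v)"
    and scale_add_left: "u \<in> lcarrier L \<Longrightarrow>
      lscale L (c + d) u = ladd L (lscale L c u) (lscale L d u)"
    and scale_scale: "u \<in> lcarrier L \<Longrightarrow> lscale L c (lscale L d u) = lscale L (c * d) u"
    and scale_one: "u \<in> lcarrier L \<Longrightarrow> lscale L 1 u = u"
    and bracket_add_left: "\<lbrakk>u \<in> lcarrier L; v \<in> lcarrier L; w \<in> lcarrier L\<rbrakk> \<Longrightarrow>
      lbracket L (ladd L u v) w = ladd L (lbracket L u w) (lbracket L v w)"
    and bracket_add_right: "\<lbrakk>u \<in> lcarrier L; v \<in> lcarrier L; w \<in> lcarrier L\<rbrakk> \<Longrightarrow>
      lbracket L u (ladd L v w) = ladd L (lbracket L u v) (lbracket L u w)"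
    and bracket_scale_left: "\<lbrakk>u \<in> lcarrier L; v \<in> lcarrier L\<rbrakk> \<Longrightarrow>
      lbracket L (lscale L c u) v = lscale L c (lbracket L u v)"
    and bracket_scale_right: "\<lbrakk>u \<in> lcarrier L; v \<in> lcarrier L\<rbrakk> \<Longrightarrow>
      lbracket L u (lscale L c v) = lscale L c (lbracket L u v)"
    and bracket_self: "u \<in> lcarrier L \<Longrightarrow> lbracket L u u = lzero L"
    and jacobi: "\<lbrakk>u \<in> lcarrier L; v \<in> lcarrier L; w \<in> lcarrier L\<rbrakk> \<Longrightarrow>
      ladd L (ladd L (lbracket L u (lbracket L v w)) (lbracket L v (lbracket L w u)))
        (lbracket L w (lbracket L u v)) = lzero L"

definition lie_algebra_hom :: "'v lie_algebra \<Rightarrow> 'w lie_algebra \<Rightarrow> ('v \<Rightarrow> 'w) \<Rightarrow> bool" where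
  "lie_algebra_hom L L' a \<longleftrightarrow>
     a \<in> lcarrier L \<rightarrow> lcarrier L' \<and>
     (\<forall>u\<in>lcarrier L. \<forall>v\<in>lcarrier L. a (ladd L u v) = ladd L' (a u) (a v)) \<and>
     (\<forall>c. \<forall>u\<in>lcarrier L. a (lscale L c u) = lscale L' c (a u)) \<and>
     (\<forall>u\<in>lcarrier L. \<forall>v\<in>lcarrier L. a (lbracket L u v) = lbracket L' (a u) (a v))"

definition sections_lie_algebra ::
  "('f, 'n, 'e::real_inner, 'k::real_inner) vbundle \<Rightarrow>
   (('n \<Rightarrow> 'f) \<Rightarrow> ('n \<Rightarrow> 'f) \<Rightarrow> 'n \<Rightarrow> 'f) \<Rightarrow> ('n \<Rightarrow> 'f) lie_algebra" where
  "sections_lie_algebra E br = \<lparr> lcarrier = sections E, ladd = sec_add E, lzero = sec_zero E,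
     lscale = (\<lambda>c. sec_scale E (\<lambda>p. c)), lbracket = br \<rparr>"

section \<open>Generalized Lie algebroids\<close>

record ('f, 'n, 'e, 'k, 'm, 'd) gla_data =
  bundleF :: "('f, 'n, 'e, 'k) vbundle"
  manM :: "('m, 'd) atlas"
  hmap :: "'m \<Rightarrow> 'n"
  etamap :: "'n \<Rightarrow> 'm"
  rho :: "'f \<Rightarrow> 'm \<times> 'm tangent_vector"
  bracket :: "('n \<Rightarrow> 'f) \<Rightarrow> ('n \<Rightarrow> 'f) \<Rightarrow> 'n \<Rightarrow> 'f"

abbreviation manN :: "('f, 'n, 'e, 'k, 'm, 'd) gla_data \<Rightarrow> ('n, 'e) atlas" where
  "manN G \<equiv> base (bundleF G)"

text \<open>The vector field \<open>a(z) = \<Gamma>(Th \<circ> \<rho>, h \<circ> \<eta>)(z)\<close>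
  on \<open>N\<close>.\<close>

definition anchor ::
  "('f, 'n, 'e::real_inner, 'k::real_inner, 'm, 'd::real_inner) gla_data \<Rightarrow>
   ('n \<Rightarrow> 'f) \<Rightarrow> 'n \<Rightarrow> 'n \<times> 'n tangent_vector" where
  "anchor G z = sec_map (bundleF G) (tangent_bundle (manN G))
     (tangent_map (manN G) (hmap G) \<circ> rho G) (hmap G \<circ> etamap G) z"

locale generalized_lie_algebroid =
  fixes G :: "('f, 'n, 'e::real_inner, 'k::real_inner, 'm, 'd::real_inner) gla_data"
  assumes manifold_M: "smooth_manifold (manM G)"
    and vector_bundle_F: "vector_bundle (bundleF G)"
    and diffeomorphism_h: "diffeomorphism (manM G) (manN G) (hmap G)"
    and diffeomorphism_eta: "diffeomorphism (manN G) (manM G) (etamap G)"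
    and morphism_rho:
      "vector_bundle_morphism (bundleF G) (tangent_bundle (manM G)) (rho G) (etamap G)"
    and leibniz: "\<lbrakk>u \<in> sections (bundleF G); v \<in> sections (bundleF G);
        f \<in> smooth_functions (manN G)\<rbrakk> \<Longrightarrow>
      bracket G u (sec_scale (bundleF G) f v) =
        sec_add (bundleF G) (sec_scale (bundleF G) f (bracket G u v))
          (sec_scale (bundleF G) (vf_act (manN G) (anchor G u) f) v)"
    and lie_algebra_F: "real_lie_algebra (sections_lie_algebra (bundleF G) (bracket G))"
    and anchor_hom:
      "lie_algebra_hom (sections_lie_algebra (bundleF G) (bracket G))
        (sections_lie_algebra (tangent_bundle (manN G)) (vf_bracket (manN G))) (anchor G)"

section \<open>Exterior forms\<close>

text \<open>
  A form of degree \<open>q\<close> is a function on lists of \<open>q\<close> sections, equal to 0 on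
  all other lists. For \<open>q = 0\<close> this identifies a smooth function with its value at
  the empty list.
\<close>

type_synonym ('f, 'n) form = "('n \<Rightarrow> 'f) list \<Rightarrow> 'n \<Rightarrow> real"

definition tuples ::
  "('f, 'n, 'e::real_inner, 'k::real_inner) vbundle \<Rightarrow> nat \<Rightarrow> ('n \<Rightarrow> 'f) list set" where
  "tuples E q = {zs. length zs = q \<and> set zs \<subseteq> sections E}"

definition forms ::
  "('f, 'n, 'e::real_inner, 'k::real_inner) vbundle \<Rightarrow> nat \<Rightarrow> ('f, 'n) form set" where
  "forms E q = {\<omega>.
     (\<forall>zs\<in>tuples E q. \<omega> zs \<in> smooth_functions (base E)) \<and>
     (\<forall>zs. zs \<notin> tuples E q \<longrightarrow> \<omega> zs = (\<lambda>p. 0)) \<and>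
     (\<forall>zs\<in>tuples E q. \<forall>i<q. \<forall>u\<in>sections E. \<forall>v\<in>sections E.
        \<omega> (zs[i := sec_add E u v]) = (\<lambda>p. \<omega> (zs[i := u]) p + \<omega> (zs[i := v]) p)) \<and>
     (\<forall>zs\<in>tuples E q. \<forall>i<q. \<forall>u\<in>sections E. \<forall>f\<in>smooth_functions (base E).
        \<omega> (zs[i := sec_scale E f u]) = (\<lambda>p. f p * \<omega> (zs[i := u]) p)) \<and>
     (\<forall>zs\<in>tuples E q. \<forall>i j. i < j \<and> j < q \<and> zs ! i = zs ! j \<longrightarrow> \<omega> zs = (\<lambda>p. 0))}"

definition shuffle_perms :: "nat \<Rightarrow> nat \<Rightarrow> (nat \<Rightarrow> nat) set" where
  "shuffle_perms q r = {\<sigma>. \<sigma> permutes {..<q + r} \<and>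
     strict_mono_on {..<q} \<sigma> \<and> strict_mono_on {q..<q + r} \<sigma>}"

definition wedge ::
  "('f, 'n, 'e::real_inner, 'k::real_inner) vbundle \<Rightarrow> nat \<Rightarrow> nat \<Rightarrow>
   ('f, 'n) form \<Rightarrow> ('f, 'n) form \<Rightarrow> ('f, 'n) form" where
  "wedge E q r \<omega> \<theta> = (\<lambda>zs p. if zs \<in> tuples E (q + r) then
     (\<Sum>\<sigma>\<in>shuffle_perms q r. of_int (sign \<sigma>) *
        \<omega> (map (\<lambda>i. zs ! \<sigma> i) [0..<q]) p * \<theta> (map (\<lambda>i. zs ! \<sigma> i) [q..<q + r]) p)
     else 0)"

definition lie_deriv ::
  "('f, 'n, 'e::real_inner, 'k::real_inner, 'm, 'd::real_inner) gla_data \<Rightarrow> nat \<Rightarrow>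
   ('n \<Rightarrow> 'f) \<Rightarrow> ('f, 'n) form \<Rightarrow> ('f, 'n) form" where
  "lie_deriv G q z \<omega> = (\<lambda>zs p. if zs \<in> tuples (bundleF G) q then
     vf_act (manN G) (anchor G z) (\<omega> zs) p
       - (\<Sum>i<q. \<omega> (zs[i := bracket G z (zs ! i)]) p)
     else 0)"

text \<open>Here \<open>nths zs (- I)\<close> is the tuple \<open>zs\<close> with the entries at the
  positions in \<open>I\<close> omitted.\<close>

definition ext_diff ::
  "('f, 'n, 'e::real_inner, 'k::real_inner, 'm, 'd::real_inner) gla_data \<Rightarrow> nat \<Rightarrow>
   ('f, 'n) form \<Rightarrow> ('f, 'n) form" where
  "ext_diff G q \<omega> = (\<lambda>zs p. if zs \<in> tuples (bundleF G) (Suc q) then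
     (\<Sum>i\<le>q. (- 1) ^ i * vf_act (manN G) (anchor G (zs ! i)) (\<omega> (nths zs (- {i}))) p)
     + (\<Sum>j\<le>q. \<Sum>i<j. (- 1) ^ (i + j) *
          \<omega> (bracket G (zs ! i) (zs ! j) # nths zs (- {i, j})) p)
     else 0)"

end

(* Both the exterior differential and the exterior product are determined by their behaviour
   under contraction i_z: Cartan's formula i_z d = L_z - d i_z, and
   i_z (w /\ t) = i_z w /\ t + (-1)^q w /\ i_z t. Together with i_w L_z = L_z i_w - i_[z,w] and
   L_[z,w] = L_z L_w - L_w L_z they give the three claims by induction on the degree. This uses
   only that the sections are a Lie algebra acting by derivations on the ring of smooth
   functions; that vector fields do act in this way is checked in charts, where
   (X f)(y) = D(f o phi^-1)(y) (w y) with w the smooth coordinate vector of X. *)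

theory Submission
  imports Defs "HOL-Library.Function_Algebras"
begin

section \<open>Exterior products by contraction\<close>

text \<open>A form is a function on lists, so contraction with z is
  \<open>\<lambda>zs. \<omega> (z # zs)\<close> and induction on the degree is induction on the
  list. Such a function does not carry its degree: q and r are therefore arguments of the product,
  and the contraction of a factor of degree 0 has to be given the value 0 explicitly. The operators
  in the theorem are cut off to 0 outside tuples of the right length, the recursive ones are not;
  congruence lemmas on \<open>tup\<close> mediate between them. All values live in the ring of all
  real functions on the ambient type, with the smooth functions as a subset closed under the
  operations, so identities are proved by ring simplification and evaluated at points only at the
  end. The price of contraction is the comparison with the given formulas: for the product a
  classification of shuffles by the position of the value 0, for the differential a bracket that has
  to be moved to the front. Each operator must also be shown to preserve alternating maps, because d
  is shown to be additive only on maps with values in the smooth functions.\<close>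

text \<open>The rule \<open>i\<^sub>z (\<omega> \<and> \<theta>) = i\<^sub>z \<omega> \<and> \<theta> + (-1)\<^sup>q \<omega> \<and> i\<^sub>z \<theta>\<close> taken as the
  definition of the product of forms of degrees \<open>q\<close> and \<open>r\<close>.\<close>

primrec wedge_rec :: "nat \<Rightarrow> nat \<Rightarrow> ('v list \<Rightarrow> 'c::comm_ring_1) \<Rightarrow> ('v list \<Rightarrow> 'c) \<Rightarrow> 'v list \<Rightarrow> 'c" where
  "wedge_rec q r \<omega> \<theta> [] = \<omega> [] * \<theta> []"
| "wedge_rec q r \<omega> \<theta> (z # zs) =
     (case q of 0 \<Rightarrow> 0 | Suc q' \<Rightarrow> wedge_rec q' r (\<lambda>zs. \<omega> (z # zs)) \<theta> zs) +
     (case r of 0 \<Rightarrow> 0 | Suc r' \<Rightarrow> (- 1) ^ q * wedge_rec q r' \<omega> (\<lambda>zs. \<theta> (z # zs)) zs)"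

section \<open>Bilinearity of the recursive product\<close>

lemma wedge_rec_zero_left: "wedge_rec q r (\<lambda>zs. 0) \<theta> zs = 0"
  by (induction zs arbitrary: q r \<theta>) (auto split: nat.split)

lemma wedge_rec_zero_right: "wedge_rec q r \<omega> (\<lambda>zs. 0) zs = 0"
  by (induction zs arbitrary: q r \<omega>) (auto split: nat.split)

lemma wedge_rec_add_left:
  "wedge_rec q r (\<lambda>zs. \<omega> zs + \<omega>' zs) \<theta> zs = wedge_rec q r \<omega> \<theta> zs + wedge_rec q r \<omega>' \<theta> zs"
proof (induction zs arbitrary: q r \<omega> \<omega>' \<theta>)
  case (Cons z zs)
  then show ?case by (cases q; cases r) (simp_all add: distrib_left)
qed (simp add: distrib_right)

lemma wedge_rec_add_right:
  "wedge_rec q r \<omega> (\<lambda>zs. \<theta> zs + \<theta>' zs) zs = wedge_rec q r \<omega> \<theta> zs + wedge_rec q r \<omega> \<theta>' zs"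
proof (induction zs arbitrary: q r \<omega> \<theta> \<theta>')
  case (Cons z zs)
  then show ?case by (cases q; cases r) (simp_all add: distrib_left)
qed (simp add: distrib_left)

lemma wedge_rec_diff_left:
  "wedge_rec q r (\<lambda>zs. \<omega> zs - \<omega>' zs) \<theta> zs = wedge_rec q r \<omega> \<theta> zs - wedge_rec q r \<omega>' \<theta> zs"
  using wedge_rec_add_left[of q r "\<lambda>zs. \<omega> zs - \<omega>' zs" \<omega>' \<theta> zs] by simp

lemma wedge_rec_diff_right:
  "wedge_rec q r \<omega> (\<lambda>zs. \<theta> zs - \<theta>' zs) zs = wedge_rec q r \<omega> \<theta> zs - wedge_rec q r \<omega> \<theta>' zs"
  using wedge_rec_add_right[of q r \<omega> "\<lambda>zs. \<theta> zs - \<theta>' zs" \<theta>' zs] by simp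

section \<open>Shuffles and the position of the value 0\<close>

text \<open>The permutation obtained from \<open>\<tau>\<close> by inserting the value 0 at position \<open>p\<close>. A
  shuffle takes the value 0 at the start of one of its two blocks, so it arises from a smaller
  shuffle with \<open>p = 0\<close> or \<open>p = q\<close>.\<close>

definition insert_zero :: "nat \<Rightarrow> (nat \<Rightarrow> nat) \<Rightarrow> nat \<Rightarrow> nat" where
  "insert_zero p \<tau> i = (if i < p then Suc (\<tau> i) else if i = p then 0 else Suc (\<tau> (i - 1)))"

text \<open>With the zero in front, positions and values of \<tau> are both shifted by one. Written
  as \<open>map_permutation\<close> along \<open>Suc\<close>, this yields the permutation property
  and the sign at once; 0 lies outside the image of \<open>Suc\<close> and is therefore
  fixed.\<close>

lemma insert_zero_0: "insert_zero 0 \<tau> = map_permutation {..<n} Suc \<tau>" if "\<tau> permutes {..<n}"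
proof
  fix i show "insert_zero 0 \<tau> i = map_permutation {..<n} Suc \<tau> i"
  proof (cases i)
    case 0
    then show ?thesis by (auto simp: insert_zero_def map_permutation_def restrict_id_def)
  next
    case (Suc j)
    show ?thesis
    proof (cases "j < n")
      case True
      then show ?thesis unfolding Suc by (subst map_permutation_apply) (auto simp: insert_zero_def)
    next
      case False
      then show ?thesis
        using permutes_not_in[OF that, of j] Suc
        by (auto simp: insert_zero_def map_permutation_def restrict_id_def)
    qed
  qed
qed

text \<open>An adjacent transposition moves the zero one place to the right, so facts about position
  p become inductions that start with the zero in front.\<close>

lemma insert_zero_Suc: "insert_zero (Suc p) \<tau> = insert_zero p \<tau> \<circ> Transposition.transpose p (Suc p)"
  by (rule ext) (auto simp: insert_zero_def Transposition.transpose_def)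

lemma insert_zero_permutes_sign:
  assumes "\<tau> permutes {..<n}" "p \<le> n"
  shows "insert_zero p \<tau> permutes {..<Suc n}" "sign (insert_zero p \<tau>) = (- 1) ^ p * sign \<tau>"
proof -
  have "insert_zero p \<tau> permutes {..<Suc n} \<and> sign (insert_zero p \<tau>) = (- 1) ^ p * sign \<tau>"
    using assms(2)
  proof (induction p)
    case 0
    have "map_permutation {..<n} Suc \<tau> permutes Suc ` {..<n}"
      by (intro map_permutation_permutes inj_on_imp_bij_betw assms(1)) auto
    moreover have "Suc ` {..<n} \<subseteq> {..<Suc n}" by auto
    ultimately have "map_permutation {..<n} Suc \<tau> permutes {..<Suc n}"
      by (rule permutes_subset)
    moreover have "sign (map_permutation {..<n} Suc \<tau>) = sign \<tau>"
      by (rule sign_map_permutation) (use assms(1) in auto)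
    ultimately show ?case by (simp add: insert_zero_0[OF assms(1)])
  next
    case (Suc p)
    then have ih: "insert_zero p \<tau> permutes {..<Suc n}" "sign (insert_zero p \<tau>) = (- 1) ^ p * sign \<tau>" by auto
    have "sign (insert_zero p \<tau> \<circ> Transposition.transpose p (Suc p)) = sign (insert_zero p \<tau>) * sign (Transposition.transpose p (Suc p))"
      using ih(1) by (intro sign_compose permutation_swap_id permutation_permutes[THEN iffD2]) auto
    moreover have "insert_zero p \<tau> \<circ> Transposition.transpose p (Suc p) permutes {..<Suc n}"
      using Suc.prems by (intro permutes_compose permutes_swap_id ih(1)) auto
    ultimately show ?case
      unfolding insert_zero_Suc using ih(2) by (simp only: sign_swap_id) simp
  qed
  then show "insert_zero p \<tau> permutes {..<Suc n}" "sign (insert_zero p \<tau>) = (- 1) ^ p * sign \<tau>" by auto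
qed

text \<open>Transpositions move the zero back to the front. There \<sigma> fixes 0 and permutes the
  positive numbers, and \<tau> is obtained by undoing the shift by one.\<close>

lemma insert_zero_surj:
  assumes "\<sigma> permutes {..<Suc n}" "\<sigma> p = 0" "p \<le> n"
  obtains \<tau> where "\<tau> permutes {..<n}" "\<sigma> = insert_zero p \<tau>"
proof -
  have "\<exists>\<tau>. \<tau> permutes {..<n} \<and> \<sigma> = insert_zero p \<tau>"
    using assms
  proof (induction p arbitrary: \<sigma>)
    case 0
    then have pos: "\<sigma> (Suc j) > 0" for j
      using permutes_inj[of \<sigma>] by (metis gr0I injD old.nat.distinct(1))
    have "(\<lambda>j. \<sigma> (Suc j) - 1) permutes {..<n}"
      unfolding permutes_def
    proof (intro conjI allI impI)
      fix j assume "j \<notin> {..<n}"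
      then show "\<sigma> (Suc j) - 1 = j"
        using permutes_not_in[OF 0(1), of "Suc j"] by simp
    next
      fix y
      obtain x where x: "\<sigma> x = Suc y"
        using permutes_surj[OF 0(1)] by (metis surjD)
      then obtain j where "x = Suc j" using 0(2) by (cases x) auto
      with x show "\<exists>!j. \<sigma> (Suc j) - 1 = y"
        using pos permutes_inj[OF 0(1)]
        by (metis Suc_pred' diff_Suc_1 injD nat.inject)
    qed
    moreover have "\<sigma> = insert_zero 0 (\<lambda>j. \<sigma> (Suc j) - 1)"
    proof
      fix i show "\<sigma> i = insert_zero 0 (\<lambda>j. \<sigma> (Suc j) - 1) i"
        using 0(2) pos[of "i - 1"] by (cases i) (auto simp: insert_zero_def)
    qed
    ultimately show ?case by blast
  next
    case (Suc p)
    have "\<sigma> \<circ> Transposition.transpose p (Suc p) permutes {..<Suc n}"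
      using Suc.prems by (intro permutes_compose permutes_swap_id) auto
    then obtain \<tau> where "\<tau> permutes {..<n}" and *: "\<sigma> \<circ> Transposition.transpose p (Suc p) = insert_zero p \<tau>"
      using Suc.IH[of "\<sigma> \<circ> Transposition.transpose p (Suc p)"] Suc.prems
      by (metis comp_apply transpose_apply_first Suc_leD)
    moreover have "\<sigma> = insert_zero (Suc p) \<tau>"
      unfolding insert_zero_Suc *[symmetric] by (simp add: comp_assoc)
    ultimately show ?case by blast
  qed
  then show thesis using that by blast
qed

lemma inj_insert_zero: "inj (insert_zero p)"
proof
  fix \<tau> \<tau>' assume *: "insert_zero p \<tau> = insert_zero p \<tau>'"
  show "\<tau> = \<tau>'"
  proof
    fix i show "\<tau> i = \<tau>' i"
      \<comment> \<open>Entry i of \<tau> is found at position i before the inserted zero and at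
        \<open>Suc i\<close> behind it.\<close>
      using fun_cong[OF *, of "if i < p then i else Suc i"] by (auto simp: insert_zero_def split: if_splits)
  qed
qed

lemma finite_shuffle_perms: "finite (shuffle_perms q r)"
  by (rule finite_subset[OF _ finite_permutations[of "{..<q + r}"]]) (auto simp: shuffle_perms_def)

text \<open>Behind the inserted zero, positions and values are shifted alike, which does not affect
  being increasing.\<close>

lemma strict_mono_on_Suc_shift:
  fixes \<sigma> \<tau> :: "nat \<Rightarrow> nat"
  assumes "\<And>i. a \<le> i \<Longrightarrow> i < b \<Longrightarrow> \<sigma> (Suc i) = Suc (\<tau> i)"
  shows "strict_mono_on {Suc a..<Suc b} \<sigma> \<longleftrightarrow> strict_mono_on {a..<b} \<tau>"
  unfolding image_Suc_atLeastLessThan[symmetric] monotone_on_def ball_simps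
  using assms by auto

lemma strict_mono_on_insert_zero:
  fixes \<sigma> :: "nat \<Rightarrow> nat"
  assumes "\<sigma> a = 0" "\<And>i. a < i \<Longrightarrow> i < b \<Longrightarrow> \<sigma> i > 0"
  shows "strict_mono_on {a..<b} \<sigma> \<longleftrightarrow> strict_mono_on {Suc a..<b} \<sigma>"
proof
  assume *: "strict_mono_on {Suc a..<b} \<sigma>"
  show "strict_mono_on {a..<b} \<sigma>"
  proof (rule strict_mono_onI)
    fix r s assume "r \<in> {a..<b}" "s \<in> {a..<b}" "r < s"
    then show "\<sigma> r < \<sigma> s"
      using assms strict_mono_onD[OF *, of r s] by (cases "r = a") auto
  qed
qed (auto intro: monotone_on_subset)

lemma shuffle_perms_permutes: "\<sigma> \<in> shuffle_perms q r \<Longrightarrow> \<sigma> permutes {..<q + r}"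
  by (simp add: shuffle_perms_def)

lemma insert_zero_0_shuffle:
  assumes "\<tau> permutes {..<q + r}"
  shows "insert_zero 0 \<tau> \<in> shuffle_perms (Suc q) r \<longleftrightarrow> \<tau> \<in> shuffle_perms q r"
proof -
  have "strict_mono_on {0..<Suc q} (insert_zero 0 \<tau>) \<longleftrightarrow> strict_mono_on {Suc 0..<Suc q} (insert_zero 0 \<tau>)"
    by (rule strict_mono_on_insert_zero) (auto simp: insert_zero_def)
  also have "\<dots> \<longleftrightarrow> strict_mono_on {0..<q} \<tau>"
    by (rule strict_mono_on_Suc_shift) (auto simp: insert_zero_def)
  finally have "strict_mono_on {0..<Suc q} (insert_zero 0 \<tau>) \<longleftrightarrow> strict_mono_on {0..<q} \<tau>" .
  moreover have "strict_mono_on {Suc q..<Suc (q + r)} (insert_zero 0 \<tau>) \<longleftrightarrow> strict_mono_on {q..<q + r} \<tau>"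
    by (rule strict_mono_on_Suc_shift) (auto simp: insert_zero_def)
  ultimately show ?thesis
    using assms insert_zero_permutes_sign(1)[OF assms, of 0] by (simp add: shuffle_perms_def lessThan_atLeast0)
qed

text \<open>The first block keeps its positions and has its values raised by one; the second block
  gains the zero at its start, below all its other values.\<close>

lemma insert_zero_shuffle:
  assumes "\<tau> permutes {..<q + r}"
  shows "insert_zero q \<tau> \<in> shuffle_perms q (Suc r) \<longleftrightarrow> \<tau> \<in> shuffle_perms q r"
proof -
  have "strict_mono_on {..<q} (insert_zero q \<tau>) \<longleftrightarrow> strict_mono_on {..<q} \<tau>"
    unfolding strict_mono_on_def by (auto simp: insert_zero_def)
  moreover have "strict_mono_on {q..<Suc (q + r)} (insert_zero q \<tau>) \<longleftrightarrow>
      strict_mono_on {Suc q..<Suc (q + r)} (insert_zero q \<tau>)"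
    by (rule strict_mono_on_insert_zero) (auto simp: insert_zero_def)
  moreover have "strict_mono_on {Suc q..<Suc (q + r)} (insert_zero q \<tau>) \<longleftrightarrow> strict_mono_on {q..<q + r} \<tau>"
    by (rule strict_mono_on_Suc_shift) (auto simp: insert_zero_def)
  ultimately show ?thesis
    using assms insert_zero_permutes_sign(1)[OF assms, of q] by (simp add: shuffle_perms_def)
qed

lemma shuffle_perms_Suc:
  assumes "q + r = Suc n"
  shows "shuffle_perms q r =
    (case q of 0 \<Rightarrow> {} | Suc k \<Rightarrow> insert_zero 0 ` shuffle_perms k r) \<union>
    (case r of 0 \<Rightarrow> {} | Suc k \<Rightarrow> insert_zero q ` shuffle_perms q k)" (is "_ = ?A \<union> ?B")
proof (intro Set.set_eqI iffI)
  fix \<sigma> assume \<sigma>: "\<sigma> \<in> shuffle_perms q r"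
  then have perm: "\<sigma> permutes {..<Suc n}" by (simp add: shuffle_perms_def assms)
  then obtain p where p: "\<sigma> p = 0" "p \<le> n"
    by (metis bot_nat_0.not_eq_extremum lessThan_iff less_Suc_eq_le permutes_def zero_less_Suc)
  \<comment> \<open>At any other position the start of the same block would have a value below
    0.\<close>
  have "(p = 0 \<and> q > 0) \<or> (p = q \<and> r > 0)"
  proof (cases "p < q")
    case True
    have "p = 0"
    proof (rule ccontr)
      assume "p \<noteq> 0"
      then have "\<sigma> 0 < \<sigma> p"
        using \<sigma> True
        by (intro strict_mono_onD[of "{..<q}" \<sigma>]) (auto simp: shuffle_perms_def)
      then show False using p by simp
    qed
    then show ?thesis using True by simp
  next
    case False
    have "p = q"
    proof (rule ccontr)
      assume "p \<noteq> q"
      then have "\<sigma> q < \<sigma> p"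
        using \<sigma> False p assms
        by (intro strict_mono_onD[of "{q..<q + r}" \<sigma>]) (auto simp: shuffle_perms_def)
      then show False using p by simp
    qed
    then show ?thesis using p assms by simp
  qed
  moreover obtain \<tau> where \<tau>: "\<tau> permutes {..<n}" "\<sigma> = insert_zero p \<tau>"
    using insert_zero_surj[OF perm p] .
  ultimately show "\<sigma> \<in> ?A \<union> ?B"
    using \<sigma> assms insert_zero_0_shuffle[of \<tau> "q - 1" r] insert_zero_shuffle[of \<tau> q "r - 1"]
    by (auto split: nat.split)
next
  fix \<sigma> assume "\<sigma> \<in> ?A \<union> ?B"
  then show "\<sigma> \<in> shuffle_perms q r"
    using insert_zero_0_shuffle shuffle_perms_permutes insert_zero_shuffle
    by (fastforce split: nat.splits)
qed

text \<open>A shuffle with the value 0 at position 0 hands the first argument to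
  \<open>\<omega>\<close>, one with 0 at position q hands it to \<open>\<theta>\<close>. These are
  the two summands of the recursion, and carrying 0 to position q costs the sign (-1)^q of the
  contraction rule.\<close>

lemma wedge_rec_shuffle_perms:
  assumes "length zs = q + r"
  shows "wedge_rec q r \<omega> \<theta> zs = (\<Sum>\<sigma>\<in>shuffle_perms q r. of_int (sign \<sigma>) *
    \<omega> (map (\<lambda>i. zs ! \<sigma> i) [0..<q]) * \<theta> (map (\<lambda>i. zs ! \<sigma> i) [q..<q + r]))"
  using assms
proof (induction zs arbitrary: q r \<omega> \<theta>)
  case Nil
  have "shuffle_perms 0 0 = {id}" by (auto simp: shuffle_perms_def strict_mono_on_def)
  then show ?case using Nil by simp
next
  case (Cons z zs)
  define F where "F = (\<lambda>\<sigma>. of_int (sign \<sigma>) *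
    \<omega> (map (\<lambda>i. (z # zs) ! \<sigma> i) [0..<q]) * \<theta> (map (\<lambda>i. (z # zs) ! \<sigma> i) [q..<q + r]))"
  define A where "A = (case q of 0 \<Rightarrow> {} | Suc k \<Rightarrow> insert_zero 0 ` shuffle_perms k r)"
  define B where "B = (case r of 0 \<Rightarrow> {} | Suc k \<Rightarrow> insert_zero q ` shuffle_perms q k)"
  have "shuffle_perms q r = A \<union> B"
    unfolding A_def B_def using Cons.prems by (intro shuffle_perms_Suc[of _ _ "length zs"]) simp
  moreover have "A \<inter> B = {}"
  proof -
    \<comment> \<open>For q = 0 the set A is empty; otherwise elements of A and B differ at position
      0, where only those of A take the value 0.\<close>
    have "insert_zero 0 \<tau> \<noteq> insert_zero (Suc k) \<tau>'" for k \<tau> \<tau>'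
      by (auto simp: insert_zero_def fun_eq_iff intro!: exI[of _ 0])
    then show ?thesis by (auto simp: A_def B_def split: nat.splits)
  qed
  moreover have "finite A" "finite B"
    by (auto simp: A_def B_def finite_shuffle_perms split: nat.split)
  ultimately have "(\<Sum>\<sigma>\<in>shuffle_perms q r. F \<sigma>) = sum F A + sum F B"
    by (simp add: sum.union_disjoint)
  moreover have "sum F A = (case q of 0 \<Rightarrow> 0 | Suc k \<Rightarrow> wedge_rec k r (\<lambda>zs. \<omega> (z # zs)) \<theta> zs)"
  proof (cases q)
    case (Suc k)
    have "sum F A = (\<Sum>\<tau>\<in>shuffle_perms k r. F (insert_zero 0 \<tau>))"
      by (simp add: A_def Suc sum.reindex[OF inj_on_subset[OF inj_insert_zero subset_UNIV]])
    also have "\<dots> = wedge_rec k r (\<lambda>zs. \<omega> (z # zs)) \<theta> zs"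
      unfolding Cons.IH[of k r, OF Cons.prems[unfolded Suc, simplified]]
    proof (rule sum.cong)
      fix \<tau> assume "\<tau> \<in> shuffle_perms k r"
      then have "sign (insert_zero 0 \<tau>) = sign \<tau>"
        using insert_zero_permutes_sign(2)[of \<tau> "k + r" 0] by (simp add: shuffle_perms_def)
      moreover have "map (\<lambda>i. (z # zs) ! insert_zero 0 \<tau> i) [0..<q] = z # map (\<lambda>i. zs ! \<tau> i) [0..<k]"
        by (simp add: Suc upt_conv_Cons map_Suc_upt[symmetric] insert_zero_def del: upt_Suc)
      moreover have "map (\<lambda>i. (z # zs) ! insert_zero 0 \<tau> i) [q..<q + r] = map (\<lambda>i. zs ! \<tau> i) [k..<k + r]"
        by (simp add: Suc map_Suc_upt[symmetric] insert_zero_def del: upt_Suc)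
      ultimately show "F (insert_zero 0 \<tau>) = of_int (sign \<tau>) * \<omega> (z # map (\<lambda>i. zs ! \<tau> i) [0..<k]) *
          \<theta> (map (\<lambda>i. zs ! \<tau> i) [k..<k + r])"
        by (simp add: F_def)
    qed simp
    finally show ?thesis by (simp add: Suc)
  qed (simp add: A_def)
  moreover have "sum F B =
      (case r of 0 \<Rightarrow> 0 | Suc k \<Rightarrow> (- 1) ^ q * wedge_rec q k \<omega> (\<lambda>zs. \<theta> (z # zs)) zs)"
  proof (cases r)
    case (Suc k)
    have "sum F B = (\<Sum>\<tau>\<in>shuffle_perms q k. F (insert_zero q \<tau>))"
      by (simp add: B_def Suc sum.reindex[OF inj_on_subset[OF inj_insert_zero subset_UNIV]])
    also have "\<dots> = (- 1) ^ q * wedge_rec q k \<omega> (\<lambda>zs. \<theta> (z # zs)) zs"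
      unfolding Cons.IH[of q k, OF Cons.prems[unfolded Suc, simplified]] sum_distrib_left
    proof (rule sum.cong)
      fix \<tau> assume "\<tau> \<in> shuffle_perms q k"
      then have "sign (insert_zero q \<tau>) = (- 1) ^ q * sign \<tau>"
        using insert_zero_permutes_sign(2)[of \<tau> "q + k" q] by (simp add: shuffle_perms_def)
      moreover have "map (\<lambda>i. (z # zs) ! insert_zero q \<tau> i) [0..<q] = map (\<lambda>i. zs ! \<tau> i) [0..<q]"
        by (simp add: insert_zero_def)
      moreover have "map (\<lambda>i. (z # zs) ! insert_zero q \<tau> i) [q..<q + r] = z # map (\<lambda>i. zs ! \<tau> i) [q..<q + k]"
        by (simp add: Suc upt_conv_Cons map_Suc_upt[symmetric] insert_zero_def del: upt_Suc)
      ultimately show "F (insert_zero q \<tau>) = (- 1) ^ q * (of_int (sign \<tau>) * \<omega> (map (\<lambda>i. zs ! \<tau> i) [0..<q]) *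
          \<theta> (z # map (\<lambda>i. zs ! \<tau> i) [q..<q + k]))"
        by (simp only: F_def mult.assoc) (simp add: mult.assoc)
    qed simp
    finally show ?thesis by (simp add: Suc)
  qed (simp add: B_def)
  ultimately show ?case by (simp add: F_def)
qed

section \<open>Cartan calculus of a Lie algebra acting by derivations\<close>

lemma length_nths_Compl_singleton:
  "i < length zs \<Longrightarrow> length (nths zs (- {i})) = length zs - 1"
proof (induction zs arbitrary: i)
  case (Cons z zs)
  have "{j. Suc j \<in> - {i}} = (case i of 0 \<Rightarrow> UNIV | Suc k \<Rightarrow> - {k})"
    by (auto split: nat.split)
  with Cons show ?case
    by (cases i; cases zs) (auto simp: nths_Cons nths_all)
qed simp

text \<open>Recursion along the list for the omissions that occur in the usual formula for d; for
  pairs i < j the first index is 0 or a successor, and the second is always a successor.\<close>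

lemma nths_Compl_simps:
  "nths (z # zs) (- {0}) = zs"
  "nths (z # zs) (- {Suc i}) = z # nths zs (- {i})"
  "nths (z # zs) (- {0, Suc j}) = nths zs (- {j})"
  "nths (z # zs) (- {Suc i, Suc j}) = z # nths zs (- {i, j})"
proof -
  have "{j. Suc j \<in> - {0}} = UNIV" "{j. Suc j \<in> - {Suc i}} = - {i}"
    "{k. Suc k \<in> - {0, Suc j}} = - {j}" "{k. Suc k \<in> - {Suc i, Suc j}} = - {i, j}"
    by auto
  then show "nths (z # zs) (- {0}) = zs" "nths (z # zs) (- {Suc i}) = z # nths zs (- {i})"
    "nths (z # zs) (- {0, Suc j}) = nths zs (- {j})"
    "nths (z # zs) (- {Suc i, Suc j}) = z # nths zs (- {i, j})"
    unfolding nths_Cons by (simp_all only:) (simp_all add: nths_all)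
qed

text \<open>Sections and smooth functions form sets rather than types, hence the carriers V and C;
  the intended ring \<open>'c\<close> consists of all real functions under pointwise operations.
  \<open>br_br\<close> is the Jacobi identity read as "bracketing with u is a derivation", the form
  in which it enters \<open>lie_br\<close>.\<close>

locale lie_module =
  fixes V :: "'v set" and add :: "'v \<Rightarrow> 'v \<Rightarrow> 'v" and zero :: 'v and br :: "'v \<Rightarrow> 'v \<Rightarrow> 'v"
    and C :: "'c::comm_ring_1 set" and act :: "'v \<Rightarrow> 'c \<Rightarrow> 'c"
  assumes add_closed: "\<lbrakk>u \<in> V; v \<in> V\<rbrakk> \<Longrightarrow> add u v \<in> V"
    and zero_closed: "zero \<in> V"
    and add_zero_zero: "add zero zero = zero"
    and br_closed: "\<lbrakk>u \<in> V; v \<in> V\<rbrakk> \<Longrightarrow> br u v \<in> V"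
    and br_add_left: "\<lbrakk>u \<in> V; v \<in> V; w \<in> V\<rbrakk> \<Longrightarrow> br (add u v) w = add (br u w) (br v w)"
    and br_add_right: "\<lbrakk>u \<in> V; v \<in> V; w \<in> V\<rbrakk> \<Longrightarrow> br u (add v w) = add (br u v) (br u w)"
    and br_self: "u \<in> V \<Longrightarrow> br u u = zero"
    and br_br: "\<lbrakk>u \<in> V; v \<in> V; w \<in> V\<rbrakk> \<Longrightarrow>
      add (br (br u v) w) (br v (br u w)) = br u (br v w)"
    and C_zero: "0 \<in> C"
    and C_add: "\<lbrakk>f \<in> C; g \<in> C\<rbrakk> \<Longrightarrow> f + g \<in> C"
    and C_uminus: "f \<in> C \<Longrightarrow> - f \<in> C"
    and C_mult: "\<lbrakk>f \<in> C; g \<in> C\<rbrakk> \<Longrightarrow> f * g \<in> C"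
    and act_closed: "\<lbrakk>u \<in> V; f \<in> C\<rbrakk> \<Longrightarrow> act u f \<in> C"
    and act_add: "\<lbrakk>u \<in> V; f \<in> C; g \<in> C\<rbrakk> \<Longrightarrow> act u (f + g) = act u f + act u g"
    and act_mult: "\<lbrakk>u \<in> V; f \<in> C; g \<in> C\<rbrakk> \<Longrightarrow> act u (f * g) = act u f * g + f * act u g"
    and act_add_left: "\<lbrakk>u \<in> V; v \<in> V; f \<in> C\<rbrakk> \<Longrightarrow> act (add u v) f = act u f + act v f"
    and act_br: "\<lbrakk>u \<in> V; v \<in> V; f \<in> C\<rbrakk> \<Longrightarrow>
      act (br u v) f = act u (act v f) - act v (act u f)"
begin

lemma act_zero: "u \<in> V \<Longrightarrow> act u 0 = 0"
  using act_add[of u 0 0] C_zero by simp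

lemma act_uminus: "\<lbrakk>u \<in> V; f \<in> C\<rbrakk> \<Longrightarrow> act u (- f) = - act u f"
  using act_add[of u f "- f"] act_zero[of u] C_uminus[of f] by (simp add: eq_neg_iff_add_eq_0 add.commute)

section \<open>Alternating forms and contraction\<close>

definition tup :: "nat \<Rightarrow> 'v list set" where
  "tup n = {zs. length zs = n \<and> set zs \<subseteq> V}"

lemma Nil_in_tup [simp]: "[] \<in> tup n \<longleftrightarrow> n = 0"
  by (auto simp: tup_def)

lemma Cons_in_tup [simp]: "z # zs \<in> tup n \<longleftrightarrow> (\<exists>m. n = Suc m \<and> z \<in> V \<and> zs \<in> tup m)"
  by (auto simp: tup_def)

text \<open>
  Alternating forms, by recursion on the degree through the contractions
  \<open>\<lambda>zs. \<omega> (z # zs)\<close>. Only additivity is kept from multilinearity; skew-symmetry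
  and the Jacobi identity need no more.
\<close>

primrec alternating :: "nat \<Rightarrow> ('v list \<Rightarrow> 'c) \<Rightarrow> bool" where
  "alternating 0 \<omega> \<longleftrightarrow> \<omega> [] \<in> C"
| "alternating (Suc n) \<omega> \<longleftrightarrow>
     (\<forall>z\<in>V. alternating n (\<lambda>zs. \<omega> (z # zs))) \<and>
     (\<forall>u\<in>V. \<forall>v\<in>V. \<forall>zs\<in>tup n. \<omega> (add u v # zs) = \<omega> (u # zs) + \<omega> (v # zs)) \<and>
     (\<forall>z\<in>V. \<forall>zs. z # zs \<in> tup n \<longrightarrow> \<omega> (z # z # zs) = 0)"

lemma tup_0: "zs \<in> tup 0 \<longleftrightarrow> zs = []"
  by (auto simp: tup_def)

lemma alt_value: "alternating n \<omega> \<Longrightarrow> zs \<in> tup n \<Longrightarrow> \<omega> zs \<in> C"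
proof (induction zs arbitrary: n \<omega>)
  case (Cons z zs)
  then obtain m where [simp]: "n = Suc m" "z \<in> V" and "zs \<in> tup m" by auto
  then show ?case using Cons.IH[of m "\<lambda>zs. \<omega> (z # zs)"] Cons.prems by simp
qed simp

text \<open>Transfers alternation from a recursive operator to its counterpart that is cut off
  outside the tuples of the right length.\<close>

lemma alt_cong:
  assumes "\<And>zs. zs \<in> tup n \<Longrightarrow> \<omega> zs = \<theta> zs" and "alternating n \<omega>"
  shows "alternating n \<theta>"
  using assms
proof (induction n arbitrary: \<omega> \<theta>)
  case (Suc n)
  have eq: "\<theta> (z # zs) = \<omega> (z # zs)" if "z \<in> V" "zs \<in> tup n" for z zs
    using Suc.prems(1)[of "z # zs"] that by simp
  have "alternating n (\<lambda>zs. \<theta> (z # zs))" if "z \<in> V" for z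
  proof (rule Suc.IH)
    show "alternating n (\<lambda>zs. \<omega> (z # zs))" using Suc.prems(2) that by simp
  qed (simp add: eq that)
  then show ?case using Suc.prems(2) by (simp add: eq add_closed)
qed auto

lemma alt_zero: "alternating n (\<lambda>zs. 0)"
  by (induction n) (auto simp: C_zero)

lemma alt_add: "alternating n \<omega> \<Longrightarrow> alternating n \<theta> \<Longrightarrow> alternating n (\<lambda>zs. \<omega> zs + \<theta> zs)"
  by (induction n arbitrary: \<omega> \<theta>) (auto simp: C_add algebra_simps)

lemma alt_uminus: "alternating n \<omega> \<Longrightarrow> alternating n (\<lambda>zs. - \<omega> zs)"
  by (induction n arbitrary: \<omega>) (auto simp: C_uminus)

lemma alt_diff: "alternating n \<omega> \<Longrightarrow> alternating n \<theta> \<Longrightarrow> alternating n (\<lambda>zs. \<omega> zs - \<theta> zs)"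
  using alt_add[of n \<omega> "\<lambda>zs. - \<theta> zs"] alt_uminus[of n \<theta>] by simp

lemma alt_sign: "alternating n \<omega> \<Longrightarrow> alternating n (\<lambda>zs. (- 1) ^ k * \<omega> zs)"
  by (cases "even k") (auto intro: alt_uminus)

lemma alt_add_arg:
  "\<lbrakk>alternating (Suc n) \<omega>; u \<in> V; v \<in> V; zs \<in> tup n\<rbrakk> \<Longrightarrow> \<omega> (add u v # zs) = \<omega> (u # zs) + \<omega> (v # zs)"
  by simp

lemma alt_contract: "\<lbrakk>alternating (Suc n) \<omega>; u \<in> V\<rbrakk> \<Longrightarrow> alternating n (\<lambda>zs. \<omega> (u # zs))"
  by simp

text \<open>Additivity at 0 + 0 = 0 leaves x = x + x.\<close>

lemma alt_zero_arg: "\<lbrakk>alternating (Suc n) \<omega>; zs \<in> tup n\<rbrakk> \<Longrightarrow> \<omega> (zero # zs) = 0"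
  using alt_add_arg[of n \<omega> zero zero zs] by (simp add: zero_closed add_zero_zero)

text \<open>Polarization: the value at the repeated argument \<open>add u v\<close> vanishes, and of
  its four terms the two with equal arguments vanish as well.\<close>

lemma alt_swap:
  assumes \<omega>: "alternating (Suc (Suc n)) \<omega>" and "u \<in> V" "v \<in> V" "zs \<in> tup n"
  shows "\<omega> (u # v # zs) = - \<omega> (v # u # zs)"
proof -
  have "\<omega> (w # add u v # zs) = \<omega> (w # u # zs) + \<omega> (w # v # zs)" if "w \<in> V" for w
    using alt_add_arg[OF alt_contract[OF \<omega> that]] assms by simp
  moreover have "\<omega> (add u v # w # zs) = \<omega> (u # w # zs) + \<omega> (v # w # zs)" if "w \<in> V" for w
    using alt_add_arg[OF \<omega>] assms that by simp
  moreover have "\<omega> (w # w # zs) = 0" if "w \<in> V" for w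
    using \<omega> assms that by simp
  ultimately have "\<omega> (u # v # zs) + \<omega> (v # u # zs) = 0"
    using assms by (metis add_closed add.right_neutral add.left_neutral)
  then show ?thesis by (simp add: eq_neg_iff_add_eq_0)
qed

section \<open>Lie derivatives of forms\<close>

definition lie :: "'v \<Rightarrow> ('v list \<Rightarrow> 'c) \<Rightarrow> 'v list \<Rightarrow> 'c" where
  "lie z \<omega> zs = act z (\<omega> zs) - (\<Sum>i<length zs. \<omega> (zs[i := br z (zs ! i)]))"

lemma lie_Nil [simp]: "lie z \<omega> [] = act z (\<omega> [])"
  by (simp add: lie_def)

text \<open>The rule i_w L_z = L_z i_w - i_[z,w]: the summand at position 0 is split off from the
  sum. Together with \<open>lie_Nil\<close> it serves as a recursion for L_z.\<close>

lemma lie_Cons: "lie z \<omega> (w # zs) = lie z (\<lambda>zs. \<omega> (w # zs)) zs - \<omega> (br z w # zs)"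
  by (simp add: lie_def sum.lessThan_Suc_shift del: sum.lessThan_Suc)

lemma lie_cong:
  assumes "\<And>zs. zs \<in> tup n \<Longrightarrow> \<omega> zs = \<theta> zs" "z \<in> V" "zs \<in> tup n"
  shows "lie z \<omega> zs = lie z \<theta> zs"
  using assms
proof (induction zs arbitrary: n \<omega> \<theta>)
  case (Cons w zs)
  then obtain m where [simp]: "n = Suc m" "w \<in> V" "z \<in> V" and zs: "zs \<in> tup m" by auto
  have "lie z (\<lambda>zs. \<omega> (w # zs)) zs = lie z (\<lambda>zs. \<theta> (w # zs)) zs"
    using Cons.prems zs by (intro Cons.IH[of m]) auto
  moreover have "\<omega> (br z w # zs) = \<theta> (br z w # zs)"
    using Cons.prems zs by (simp add: br_closed)
  ultimately show ?case by (simp add: lie_Cons)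
qed simp

lemma lie_zero: "z \<in> V \<Longrightarrow> lie z (\<lambda>zs. 0) zs = 0"
  by (simp add: lie_def act_zero)

lemma lie_add:
  assumes "alternating n \<omega>" "alternating n \<theta>" "z \<in> V" "zs \<in> tup n"
  shows "lie z (\<lambda>zs. \<omega> zs + \<theta> zs) zs = lie z \<omega> zs + lie z \<theta> zs"
  using assms by (simp add: lie_def act_add alt_value sum.distrib)

lemma lie_uminus:
  assumes "alternating n \<omega>" "z \<in> V" "zs \<in> tup n"
  shows "lie z (\<lambda>zs. - \<omega> zs) zs = - lie z \<omega> zs"
  using assms by (simp add: lie_def act_uminus alt_value sum_negf)

lemma lie_diff:
  assumes "alternating n \<omega>" "alternating n \<theta>" "z \<in> V" "zs \<in> tup n"
  shows "lie z (\<lambda>zs. \<omega> zs - \<theta> zs) zs = lie z \<omega> zs - lie z \<theta> zs"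
  using lie_add[of n \<omega> "\<lambda>zs. - \<theta> zs" z zs] assms by (simp add: alt_uminus lie_uminus)

lemma lie_sign:
  assumes "alternating n \<omega>" "z \<in> V" "zs \<in> tup n"
  shows "lie z (\<lambda>zs. (- 1) ^ k * \<omega> zs) zs = (- 1) ^ k * lie z \<omega> zs"
  using assms by (cases "even k") (auto simp: lie_uminus)

lemma alt_lie:
  assumes "alternating n \<omega>" "z \<in> V"
  shows "alternating n (lie z \<omega>)"
  using assms
proof (induction n arbitrary: \<omega>)
  case (Suc n)
  note \<omega> = \<open>alternating (Suc n) \<omega>\<close> and z = \<open>z \<in> V\<close>
  show ?case
    unfolding alternating.simps
  proof (intro conjI ballI allI impI)
    fix w assume w: "w \<in> V"
    show "alternating n (\<lambda>zs. lie z \<omega> (w # zs))"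
      unfolding lie_Cons
      using Suc.IH[OF alt_contract[OF \<omega> w] z] alt_contract[OF \<omega> br_closed[OF z w]]
      by (rule alt_diff)
  next
    fix u v zs assume uv: "u \<in> V" "v \<in> V" and zs: "zs \<in> tup n"
    have "lie z (\<lambda>zs. \<omega> (add u v # zs)) zs = lie z (\<lambda>zs. \<omega> (u # zs) + \<omega> (v # zs)) zs"
      using \<omega> uv by (intro lie_cong[OF _ z zs]) simp
    also have "\<dots> = lie z (\<lambda>zs. \<omega> (u # zs)) zs + lie z (\<lambda>zs. \<omega> (v # zs)) zs"
      using lie_add[OF alt_contract[OF \<omega> uv(1)] alt_contract[OF \<omega> uv(2)] z zs] .
    finally show "lie z \<omega> (add u v # zs) = lie z \<omega> (u # zs) + lie z \<omega> (v # zs)"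
      using alt_add_arg[OF \<omega> br_closed[OF z uv(1)] br_closed[OF z uv(2)] zs] uv z
      by (simp add: lie_Cons br_add_right)
  next
    fix w zs assume w: "w \<in> V" and "w # zs \<in> tup n"
    then obtain m where n: "n = Suc m" and zs: "zs \<in> tup m" by auto
    have "lie z (\<lambda>zs. \<omega> (w # w # zs)) zs = lie z (\<lambda>zs. 0) zs"
      using \<omega> w n by (intro lie_cong[OF _ z zs]) simp
    \<comment> \<open>On a repeated argument the Lie derivative leaves the two values with one w
      replaced by [z,w]; by skew-symmetry they cancel.\<close>
    moreover have "\<omega> (w # br z w # zs) = - \<omega> (br z w # w # zs)"
      using alt_swap[OF _ w br_closed[OF z w] zs] \<omega> n by blast
    ultimately show "lie z \<omega> (w # w # zs) = 0"
      by (simp add: lie_Cons lie_zero z)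
  qed
qed (simp add: act_closed)

text \<open>This is what makes \<open>d \<omega>\<close> additive in its first argument.\<close>

lemma lie_add_left:
  assumes "alternating n \<omega>" "u \<in> V" "v \<in> V" "zs \<in> tup n"
  shows "lie (add u v) \<omega> zs = lie u \<omega> zs + lie v \<omega> zs"
  using assms
proof (induction zs arbitrary: n \<omega>)
  case (Cons w zs)
  then obtain m where n: "n = Suc m" and w: "w \<in> V" and zs: "zs \<in> tup m" by auto
  have "lie (add u v) (\<lambda>zs. \<omega> (w # zs)) zs = lie u (\<lambda>zs. \<omega> (w # zs)) zs + lie v (\<lambda>zs. \<omega> (w # zs)) zs"
    using Cons.prems n w zs by (intro Cons.IH[of m]) auto
  moreover have "\<omega> (br (add u v) w # zs) = \<omega> (br u w # zs) + \<omega> (br v w # zs)"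
    using Cons.prems n w zs by (simp add: br_add_left br_closed)
  ultimately show ?case by (simp add: lie_Cons)
qed (simp add: act_add_left)

text \<open>On functions this is the action of a bracket. Contraction with w adds only the terms
  i_[[u,v],w], i_[u,[v,w]] and i_[v,[u,w]], which are balanced by the Jacobi identity.\<close>

lemma lie_br:
  assumes "alternating n \<omega>" "u \<in> V" "v \<in> V" "zs \<in> tup n"
  shows "lie (br u v) \<omega> zs = lie u (lie v \<omega>) zs - lie v (lie u \<omega>) zs"
  using assms
proof (induction zs arbitrary: n \<omega>)
  case (Cons w zs)
  then obtain m where [simp]: "n = Suc m" and w: "w \<in> V" and zs: "zs \<in> tup m" by auto
  note \<omega> = \<open>alternating n \<omega>\<close>[simplified \<open>n = Suc m\<close>]
  \<comment> \<open>The two middle terms are exchanged when x and y are exchanged, so they drop out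
    of the commutator.\<close>
  have *: "lie x (lie y \<omega>) (w # zs) = lie x (lie y (\<lambda>zs. \<omega> (w # zs))) zs
       - lie x (\<lambda>zs. \<omega> (br y w # zs)) zs - lie y (\<lambda>zs. \<omega> (br x w # zs)) zs + \<omega> (br y (br x w) # zs)"
    if "x \<in> V" "y \<in> V" for x y
  proof -
    have "lie x (\<lambda>zs. lie y \<omega> (w # zs)) zs
        = lie x (lie y (\<lambda>zs. \<omega> (w # zs))) zs - lie x (\<lambda>zs. \<omega> (br y w # zs)) zs"
      unfolding lie_Cons using that w zs
      by (intro lie_diff[of m] alt_lie alt_contract[OF \<omega>] br_closed)
    then show ?thesis by (simp add: lie_Cons)
  qed
  have "\<omega> (br u (br v w) # zs) = \<omega> (br (br u v) w # zs) + \<omega> (br v (br u w) # zs)"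
    using alt_add_arg[OF \<omega> _ _ zs, of "br (br u v) w" "br v (br u w)"] Cons.prems w
    by (simp add: br_br br_closed)
  moreover have "lie (br u v) (\<lambda>zs. \<omega> (w # zs)) zs =
      lie u (lie v (\<lambda>zs. \<omega> (w # zs))) zs - lie v (lie u (\<lambda>zs. \<omega> (w # zs))) zs"
    using Cons.prems w zs by (intro Cons.IH[of m]) auto
  ultimately show ?case
    using Cons.prems by (simp add: * lie_Cons[of "br u v"])
qed (simp add: act_br)

section \<open>The exterior differential and its commutation with Lie derivatives\<close>

text \<open>Cartan's formula \<open>i\<^sub>z d = L\<^sub>z - d i\<^sub>z\<close> taken as the definition;
  \<open>d_eq\<close> recovers the usual one.\<close>

primrec d :: "('v list \<Rightarrow> 'c) \<Rightarrow> 'v list \<Rightarrow> 'c" where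
  "d \<omega> [] = 0"
| "d \<omega> (z # zs) = lie z \<omega> zs - d (\<lambda>zs. \<omega> (z # zs)) zs"

lemma d_cong:
  assumes "\<And>zs. zs \<in> tup n \<Longrightarrow> \<omega> zs = \<theta> zs" "zs \<in> tup (Suc n)"
  shows "d \<omega> zs = d \<theta> zs"
  using assms
proof (induction zs arbitrary: n \<omega> \<theta>)
  case (Cons z zs)
  then have z: "z \<in> V" and zs: "zs \<in> tup n" by auto
  have "lie z \<omega> zs = lie z \<theta> zs"
    using Cons.prems z zs by (intro lie_cong[of n]) auto
  moreover have "d (\<lambda>zs. \<omega> (z # zs)) zs = d (\<lambda>zs. \<theta> (z # zs)) zs"
  \<comment> \<open>For n = 0 there is no lower degree to refer to, but then zs is empty and d is 0
    there by definition. The same split recurs below.\<close>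
  proof (cases n)
    case 0
    then show ?thesis using zs by (simp add: tup_0)
  next
    case (Suc m)
    then show ?thesis using Cons.prems z zs by (intro Cons.IH[of m]) auto
  qed
  ultimately show ?case by simp
qed simp

lemma d_zero: "set zs \<subseteq> V \<Longrightarrow> d (\<lambda>zs. 0) zs = 0"
  by (induction zs) (auto simp: lie_zero)

lemma d_add:
  assumes "alternating n \<omega>" "alternating n \<theta>" "zs \<in> tup (Suc n)"
  shows "d (\<lambda>zs. \<omega> zs + \<theta> zs) zs = d \<omega> zs + d \<theta> zs"
  using assms
proof (induction zs arbitrary: n \<omega> \<theta>)
  case (Cons z zs)
  then have z: "z \<in> V" and zs: "zs \<in> tup n" by auto
  have "d (\<lambda>zs. \<omega> (z # zs) + \<theta> (z # zs)) zs = d (\<lambda>zs. \<omega> (z # zs)) zs + d (\<lambda>zs. \<theta> (z # zs)) zs"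
  proof (cases n)
    case 0
    then show ?thesis using zs by (simp add: tup_0)
  next
    case (Suc m)
    then show ?thesis using Cons.prems z zs by (intro Cons.IH[of m]) auto
  qed
  then show ?case using lie_add[OF Cons.prems(1,2) z zs] by simp
qed simp

lemma d_uminus:
  assumes "alternating n \<omega>" "zs \<in> tup (Suc n)"
  shows "d (\<lambda>zs. - \<omega> zs) zs = - d \<omega> zs"
proof -
  have "set zs \<subseteq> V" using assms by (simp add: tup_def)
  then show ?thesis
    using d_add[OF assms(1) alt_uminus[OF assms(1)] assms(2)]
    by (simp add: d_zero eq_neg_iff_add_eq_0 add.commute)
qed

lemma d_diff:
  assumes "alternating n \<omega>" "alternating n \<theta>" "zs \<in> tup (Suc n)"
  shows "d (\<lambda>zs. \<omega> zs - \<theta> zs) zs = d \<omega> zs - d \<theta> zs"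
  using d_add[of n \<omega> "\<lambda>zs. - \<theta> zs" zs] assms by (simp add: alt_uminus d_uminus)

lemma d_sign:
  assumes "alternating n \<omega>" "zs \<in> tup (Suc n)"
  shows "d (\<lambda>zs. (- 1) ^ k * \<omega> zs) zs = (- 1) ^ k * d \<omega> zs"
  using assms by (cases "even k") (auto simp: d_uminus)

text \<open>On a repeated argument z the two terms L_z i_z \<omega> cancel. What remains is the
  value of \<omega> at [z,z] = 0 and d applied to i_z i_z \<omega> = 0.\<close>

lemma alt_d: "alternating n \<omega> \<Longrightarrow> alternating (Suc n) (d \<omega>)"
proof (induction n arbitrary: \<omega>)
  case 0
  then show ?case
    by (auto simp: act_closed act_add_left tup_0 C_add C_uminus)
next
  case (Suc n)
  note \<omega> = \<open>alternating (Suc n) \<omega>\<close>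
  show ?case
    unfolding alternating.simps(2)[of "Suc n"]
  proof (intro conjI ballI allI impI)
    fix z assume z: "z \<in> V"
    show "alternating (Suc n) (\<lambda>zs. d \<omega> (z # zs))"
      unfolding d.simps
      using alt_lie[OF \<omega> z] Suc.IH[OF alt_contract[OF \<omega> z]] by (rule alt_diff)
  next
    fix u v zs assume uv: "u \<in> V" "v \<in> V" and zs: "zs \<in> tup (Suc n)"
    have "d (\<lambda>zs. \<omega> (add u v # zs)) zs = d (\<lambda>zs. \<omega> (u # zs) + \<omega> (v # zs)) zs"
      using \<omega> uv by (intro d_cong[OF _ zs]) simp
    also have "\<dots> = d (\<lambda>zs. \<omega> (u # zs)) zs + d (\<lambda>zs. \<omega> (v # zs)) zs"
      using d_add[OF alt_contract[OF \<omega> uv(1)] alt_contract[OF \<omega> uv(2)] zs] .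
    finally show "d \<omega> (add u v # zs) = d \<omega> (u # zs) + d \<omega> (v # zs)"
      using lie_add_left[OF \<omega> uv zs] by simp
  next
    fix z zs assume z: "z \<in> V" and "z # zs \<in> tup (Suc n)"
    then have zs: "zs \<in> tup n" by simp
    have "d (\<lambda>zs. \<omega> (z # z # zs)) zs = 0"
    proof (cases n)
      case 0
      then show ?thesis using zs by (simp add: tup_0)
    next
      case (Suc m)
      have "d (\<lambda>zs. \<omega> (z # z # zs)) zs = d (\<lambda>zs. 0) zs"
        using \<omega> z zs unfolding Suc by (intro d_cong[of m]) simp_all
      then show ?thesis using zs by (simp add: d_zero tup_def)
    qed
    then show "d \<omega> (z # z # zs) = 0"
      using alt_zero_arg[OF \<omega> zs] z by (simp add: lie_Cons br_self)
  qed
qed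

text \<open>Contracted with w, the two sides become L_z L_w - L_z d i_w - L_[z,w] + d i_[z,w] and
  L_w L_z - d L_z i_w + d i_[z,w]. They agree by \<open>lie_br\<close> and by the induction
  hypothesis for i_w \<omega>.\<close>

theorem lie_d:
  assumes "alternating n \<omega>" "z \<in> V" "zs \<in> tup (Suc n)"
  shows "lie z (d \<omega>) zs = d (lie z \<omega>) zs"
  using assms
proof (induction n arbitrary: \<omega> zs)
  case 0
  then obtain w where "zs = [w]" "w \<in> V" by (cases zs) (auto simp: tup_0)
  with 0 show ?case by (simp add: lie_Cons act_br)
next
  case (Suc n)
  then obtain w ws where [simp]: "zs = w # ws" and w: "w \<in> V" and ws: "ws \<in> tup (Suc n)"
    by (cases zs) auto
  note \<omega> = \<open>alternating (Suc n) \<omega>\<close> and z = \<open>z \<in> V\<close>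
  note w\<omega> = alt_contract[OF \<omega> w] and zw = br_closed[OF z w]
  have "lie z (d \<omega>) zs = lie z (\<lambda>zs. lie w \<omega> zs - d (\<lambda>zs. \<omega> (w # zs)) zs) ws - d \<omega> (br z w # ws)"
    by (simp add: lie_Cons)
  also have "\<dots> = lie z (lie w \<omega>) ws - lie z (d (\<lambda>zs. \<omega> (w # zs))) ws - d \<omega> (br z w # ws)"
    using lie_diff[OF alt_lie[OF \<omega> w] alt_d[OF w\<omega>] z ws] by simp
  also have "lie z (d (\<lambda>zs. \<omega> (w # zs))) ws = d (lie z (\<lambda>zs. \<omega> (w # zs))) ws"
    using Suc.IH[OF w\<omega> z ws] .
  also have "d \<omega> (br z w # ws) = lie z (lie w \<omega>) ws - lie w (lie z \<omega>) ws
      - d (\<lambda>zs. \<omega> (br z w # zs)) ws"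
    using lie_br[OF \<omega> z w ws] by simp
  also have "lie z (lie w \<omega>) ws - d (lie z (\<lambda>zs. \<omega> (w # zs))) ws -
      (lie z (lie w \<omega>) ws - lie w (lie z \<omega>) ws - d (\<lambda>zs. \<omega> (br z w # zs)) ws)
    = lie w (lie z \<omega>) ws - (d (lie z (\<lambda>zs. \<omega> (w # zs))) ws - d (\<lambda>zs. \<omega> (br z w # zs)) ws)"
    by simp
  also have "\<dots> = d (lie z \<omega>) zs"
    using d_diff[OF alt_lie[OF w\<omega> z] alt_contract[OF \<omega> zw] ws] by (simp add: lie_Cons)
  finally show ?case .
qed

text \<open>Contraction with w gives i_w d d = (L_w d - d L_w) + d d i_w: the bracket vanishes by
  \<open>lie_d\<close>, the last term by induction. In degree 0 the value at u, v is u(v f) - [u,v]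
  f - v(u f).\<close>

theorem d_d:
  assumes "alternating n \<omega>" "zs \<in> tup (Suc (Suc n))"
  shows "d (d \<omega>) zs = 0"
  using assms
proof (induction n arbitrary: \<omega> zs)
  case 0
  then obtain u v where "zs = [u, v]" "u \<in> V" "v \<in> V" by (cases zs; cases "tl zs") (auto simp: tup_0)
  with 0 show ?case by (simp add: lie_Cons act_br)
next
  case (Suc n)
  then obtain w ws where [simp]: "zs = w # ws" and w: "w \<in> V" and ws: "ws \<in> tup (Suc (Suc n))"
    by (cases zs) auto
  note \<omega> = \<open>alternating (Suc n) \<omega>\<close>
  note w\<omega> = alt_contract[OF \<omega> w]
  show ?case
    using d_diff[OF alt_lie[OF \<omega> w] alt_d[OF w\<omega>] ws] lie_d[OF \<omega> w ws] Suc.IH[OF w\<omega> ws] by simp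
qed

section \<open>Exterior products under Lie derivative and differential\<close>

lemma wedge_rec_cong:
  assumes "\<And>zs. zs \<in> tup q \<Longrightarrow> \<omega> zs = \<omega>' zs" "\<And>zs. zs \<in> tup r \<Longrightarrow> \<theta> zs = \<theta>' zs"
    and "zs \<in> tup (q + r)"
  shows "wedge_rec q r \<omega> \<theta> zs = wedge_rec q r \<omega>' \<theta>' zs"
  using assms
proof (induction zs arbitrary: q r \<omega> \<theta> \<omega>' \<theta>')
  case (Cons z zs)
  then have z: "z \<in> V" by auto
  have "wedge_rec k r (\<lambda>zs. \<omega> (z # zs)) \<theta> zs = wedge_rec k r (\<lambda>zs. \<omega>' (z # zs)) \<theta>' zs" if "q = Suc k" for k
    using Cons.prems that by (intro Cons.IH) auto
  moreover have "wedge_rec q k \<omega> (\<lambda>zs. \<theta> (z # zs)) zs = wedge_rec q k \<omega>' (\<lambda>zs. \<theta>' (z # zs)) zs" if "r = Suc k" for k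
    using Cons.prems that by (intro Cons.IH) auto
  ultimately show ?case by (auto split: nat.split)
qed (auto simp: tup_0)

lemma alt_wedge_rec:
  assumes "alternating q \<omega>" "alternating r \<theta>" "n = q + r"
  shows "alternating n (wedge_rec q r \<omega> \<theta>)"
  using assms
proof (induction n arbitrary: q r \<omega> \<theta>)
  case 0
  then show ?case by (simp add: C_mult)
next
  case (Suc n)
  note \<omega> = \<open>alternating q \<omega>\<close> and \<theta> = \<open>alternating r \<theta>\<close>
  show ?case
    unfolding alternating.simps(2)[of n]
  proof (intro conjI ballI allI impI)
    fix z assume z: "z \<in> V"
    have "alternating n (wedge_rec k r (\<lambda>zs. \<omega> (z # zs)) \<theta>)" if "q = Suc k" for k
      using Suc.prems that z by (intro Suc.IH) auto
    moreover have "alternating n (\<lambda>zs. (- 1) ^ q * wedge_rec q k \<omega> (\<lambda>zs. \<theta> (z # zs)) zs)" if "r = Suc k" for k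
      using Suc.prems that z by (intro Suc.IH alt_sign) auto
    ultimately show "alternating n (\<lambda>zs. wedge_rec q r \<omega> \<theta> (z # zs))"
      by (cases q; cases r; simp only: wedge_rec.simps nat.case)
        (auto intro!: alt_add alt_zero simp del: power_Suc)
  next
    fix u v zs assume uv: "u \<in> V" "v \<in> V" and zs: "zs \<in> tup n"
    have "wedge_rec k r (\<lambda>zs. \<omega> (add u v # zs)) \<theta> zs =
        wedge_rec k r (\<lambda>zs. \<omega> (u # zs)) \<theta> zs + wedge_rec k r (\<lambda>zs. \<omega> (v # zs)) \<theta> zs" if "q = Suc k" for k
      unfolding wedge_rec_add_left[symmetric] using Suc.prems that zs uv by (intro wedge_rec_cong) auto
    moreover have "wedge_rec q k \<omega> (\<lambda>zs. \<theta> (add u v # zs)) zs =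
        wedge_rec q k \<omega> (\<lambda>zs. \<theta> (u # zs)) zs + wedge_rec q k \<omega> (\<lambda>zs. \<theta> (v # zs)) zs" if "r = Suc k" for k
      unfolding wedge_rec_add_right[symmetric] using Suc.prems that zs uv by (intro wedge_rec_cong) auto
    ultimately show "wedge_rec q r \<omega> \<theta> (add u v # zs) = wedge_rec q r \<omega> \<theta> (u # zs) + wedge_rec q r \<omega> \<theta> (v # zs)"
      by (auto simp: algebra_simps split: nat.split)
  next
    fix z zs assume z: "z \<in> V" and "z # zs \<in> tup n"
    then obtain m where n: "n = Suc m" and zs: "zs \<in> tup m" by auto
    \<comment> \<open>If both copies of z go to the same factor the term is zero. The two ways of
      giving one copy to each factor carry the signs (-1)^(q-1) and (-1)^q and cancel in the final
      simplification.\<close>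
    have "wedge_rec k r (\<lambda>zs. \<omega> (z # z # zs)) \<theta> zs = 0" if "q = Suc (Suc k)" for k
    proof -
      have "wedge_rec k r (\<lambda>zs. \<omega> (z # z # zs)) \<theta> zs = wedge_rec k r (\<lambda>zs. 0) \<theta> zs"
        using Suc.prems that zs z n by (intro wedge_rec_cong) auto
      then show ?thesis by (simp add: wedge_rec_zero_left)
    qed
    moreover have "wedge_rec q k \<omega> (\<lambda>zs. \<theta> (z # z # zs)) zs = 0" if "r = Suc (Suc k)" for k
    proof -
      have "wedge_rec q k \<omega> (\<lambda>zs. \<theta> (z # z # zs)) zs = wedge_rec q k \<omega> (\<lambda>zs. 0) zs"
        using Suc.prems that zs z n by (intro wedge_rec_cong) auto
      then show ?thesis by (simp add: wedge_rec_zero_right)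
    qed
    ultimately show "wedge_rec q r \<omega> \<theta> (z # z # zs) = 0"
      by (auto split: nat.split)
  qed
qed

lemma lie_wedge_rec:
  assumes "alternating q \<omega>" "alternating r \<theta>" "z \<in> V" "zs \<in> tup (q + r)"
  shows "lie z (wedge_rec q r \<omega> \<theta>) zs = wedge_rec q r (lie z \<omega>) \<theta> zs + wedge_rec q r \<omega> (lie z \<theta>) zs"
  using assms
proof (induction zs arbitrary: q r \<omega> \<theta>)
  case Nil
  then show ?case by (simp add: act_mult)
next
  case (Cons w zs)
  note \<omega> = \<open>alternating q \<omega>\<close> and \<theta> = \<open>alternating r \<theta>\<close> and z = \<open>z \<in> V\<close>
  from Cons.prems obtain n where n: "q + r = Suc n" and w: "w \<in> V" and zs: "zs \<in> tup n" by auto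
  \<comment> \<open>A and B are the two halves of the contraction of the product with w, with value
    0 if the factor has degree 0; the sign (-1)^q is kept outside B. The remaining terms i_[z,w] of
    the factors reassemble to i_[z,w] of the product.\<close>
  define A where "A = (\<lambda>zs. case q of 0 \<Rightarrow> 0 | Suc k \<Rightarrow> wedge_rec k r (\<lambda>zs. \<omega> (w # zs)) \<theta> zs)"
  define B where "B = (\<lambda>zs. case r of 0 \<Rightarrow> 0 | Suc k \<Rightarrow> wedge_rec q k \<omega> (\<lambda>zs. \<theta> (w # zs)) zs)"
  have A: "alternating n A"
    using \<omega> \<theta> w n by (cases q) (auto simp: A_def alt_zero intro!: alt_wedge_rec)
  have B: "alternating n B"
    using \<omega> \<theta> w n by (cases r) (auto simp: B_def alt_zero intro!: alt_wedge_rec)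
  have lA: "lie z A zs = (case q of 0 \<Rightarrow> 0 | Suc k \<Rightarrow>
      wedge_rec k r (lie z (\<lambda>zs. \<omega> (w # zs))) \<theta> zs + wedge_rec k r (\<lambda>zs. \<omega> (w # zs)) (lie z \<theta>) zs)"
    using Cons.prems w n zs Cons.IH[of "q - 1" "\<lambda>zs. \<omega> (w # zs)" r \<theta>]
    by (auto simp: A_def lie_zero split: nat.split)
  have lB: "lie z B zs = (case r of 0 \<Rightarrow> 0 | Suc k \<Rightarrow>
      wedge_rec q k (lie z \<omega>) (\<lambda>zs. \<theta> (w # zs)) zs + wedge_rec q k \<omega> (lie z (\<lambda>zs. \<theta> (w # zs))) zs)"
    using Cons.prems w n zs Cons.IH[of q \<omega> "r - 1" "\<lambda>zs. \<theta> (w # zs)"]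
    by (auto simp: B_def lie_zero split: nat.split)
  have "(\<lambda>zs. wedge_rec q r \<omega> \<theta> (w # zs)) = (\<lambda>zs. A zs + (- 1) ^ q * B zs)"
    by (auto simp: A_def B_def split: nat.split)
  then have "lie z (\<lambda>zs. wedge_rec q r \<omega> \<theta> (w # zs)) zs = lie z A zs + (- 1) ^ q * lie z B zs"
    using lie_add[OF A alt_sign[OF B] z zs] lie_sign[OF B z zs] by simp
  then show ?case
    unfolding lA lB
    by (cases q; cases r) (simp_all add: lie_Cons wedge_rec_diff_left wedge_rec_diff_right algebra_simps)
qed

text \<open>By Cartan's formula, contraction with z reduces the claim to the derivation rule for L_z
  and to the claim for the two products in which z has been contracted into one factor.\<close>

theorem d_wedge_rec:
  assumes "alternating q \<omega>" "alternating r \<theta>" "zs \<in> tup (Suc (q + r))"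
  shows "d (wedge_rec q r \<omega> \<theta>) zs = wedge_rec (Suc q) r (d \<omega>) \<theta> zs + (- 1) ^ q * wedge_rec q (Suc r) \<omega> (d \<theta>) zs"
  using assms
proof (induction zs arbitrary: q r \<omega> \<theta>)
  case (Cons z zs)
  note \<omega> = \<open>alternating q \<omega>\<close> and \<theta> = \<open>alternating r \<theta>\<close>
  from Cons.prems have z: "z \<in> V" and zs: "zs \<in> tup (q + r)" by auto
  define A where "A = (\<lambda>zs. case q of 0 \<Rightarrow> 0 | Suc k \<Rightarrow> wedge_rec k r (\<lambda>zs. \<omega> (z # zs)) \<theta> zs)"
  define B where "B = (\<lambda>zs. case r of 0 \<Rightarrow> 0 | Suc k \<Rightarrow> wedge_rec q k \<omega> (\<lambda>zs. \<theta> (z # zs)) zs)"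
  have "d (\<lambda>zs. wedge_rec q r \<omega> \<theta> (z # zs)) zs = d A zs + (- 1) ^ q * d B zs"
  proof (cases "q + r")
    case 0
    then show ?thesis using zs by (simp add: tup_0)
  next
    case (Suc n)
    have A: "alternating n A"
      using \<omega> \<theta> z Suc by (cases q) (auto simp: A_def alt_zero intro!: alt_wedge_rec)
    have B: "alternating n B"
      using \<omega> \<theta> z Suc by (cases r) (auto simp: B_def alt_zero intro!: alt_wedge_rec)
    have "(\<lambda>zs. wedge_rec q r \<omega> \<theta> (z # zs)) = (\<lambda>zs. A zs + (- 1) ^ q * B zs)"
      by (auto simp: A_def B_def split: nat.split)
    then show ?thesis
      using d_add[OF A alt_sign[OF B]] d_sign[OF B] zs Suc by simp
  qed
  moreover have "d A zs = (case q of 0 \<Rightarrow> 0 | Suc k \<Rightarrow>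
      wedge_rec q r (d (\<lambda>zs. \<omega> (z # zs))) \<theta> zs + (- 1) ^ k * wedge_rec k (Suc r) (\<lambda>zs. \<omega> (z # zs)) (d \<theta>) zs)"
    using Cons.prems z zs Cons.IH[of "q - 1" "\<lambda>zs. \<omega> (z # zs)" r \<theta>]
    by (auto simp: A_def d_zero tup_def split: nat.split)
  moreover have "d B zs = (case r of 0 \<Rightarrow> 0 | Suc k \<Rightarrow>
      wedge_rec (Suc q) k (d \<omega>) (\<lambda>zs. \<theta> (z # zs)) zs + (- 1) ^ q * wedge_rec q r \<omega> (d (\<lambda>zs. \<theta> (z # zs))) zs)"
    using Cons.prems z zs Cons.IH[of q \<omega> "r - 1" "\<lambda>zs. \<theta> (z # zs)"]
    by (auto simp: B_def d_zero tup_def split: nat.split)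
  \<comment> \<open>Even for q = 0 the contraction of \<open>d \<omega>\<close> is written as L_z
    \<omega> minus a differential; the latter is taken at the empty list, where it is 0.\<close>
  moreover have "wedge_rec 0 r (d (\<lambda>zs. \<omega> (z # zs))) \<theta> zs = 0" if "q = 0"
  proof -
    have "wedge_rec 0 r (d (\<lambda>zs. \<omega> (z # zs))) \<theta> zs = wedge_rec 0 r (\<lambda>zs. 0) \<theta> zs"
      using zs that by (intro wedge_rec_cong) (auto simp: tup_0)
    then show ?thesis by (simp add: wedge_rec_zero_left)
  qed
  moreover have "wedge_rec q 0 \<omega> (d (\<lambda>zs. \<theta> (z # zs))) zs = 0" if "r = 0"
  proof -
    have "wedge_rec q 0 \<omega> (d (\<lambda>zs. \<theta> (z # zs))) zs = wedge_rec q 0 \<omega> (\<lambda>zs. 0) zs"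
      using zs that by (intro wedge_rec_cong) (auto simp: tup_0)
    then show ?thesis by (simp add: wedge_rec_zero_right)
  qed
  \<comment> \<open>In the terms where z is contracted into \<theta> while d or L_z also acts on
    \<theta>, the sign (-1)^q arises twice: from the contraction and from passing d over
    \<omega>.\<close>
  moreover have "(- 1) ^ q * ((- 1) ^ q * x) = x" for x :: 'c
    by (simp flip: mult.assoc power_add mult_2)
  ultimately show ?case
    using lie_wedge_rec[OF \<omega> \<theta> z zs]
    by (cases q; cases r) (simp_all add: wedge_rec_diff_left wedge_rec_diff_right algebra_simps)
qed simp

section \<open>Agreement with the usual formula for the differential\<close>

lemma nths_Compl_in_tup: "zs \<in> tup (Suc n) \<Longrightarrow> i \<le> n \<Longrightarrow> nths zs (- {i}) \<in> tup n"
  using set_nths_subset[of zs "- {i}"] by (auto simp: tup_def length_nths_Compl_singleton)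

lemma nths_Compl2_in_tup:
  "zs \<in> tup (Suc (Suc n)) \<Longrightarrow> j \<le> Suc n \<Longrightarrow> i < j \<Longrightarrow> nths zs (- {i, j}) \<in> tup n"
proof (induction zs arbitrary: n i j)
  case (Cons z zs)
  then obtain k where [simp]: "j = Suc k" and zs: "zs \<in> tup (Suc n)" by (cases j) auto
  show ?case
  proof (cases i)
    case 0
    then show ?thesis using Cons.prems zs by (simp add: nths_Compl_simps nths_Compl_in_tup)
  next
    case (Suc l)
    then obtain m where "n = Suc m" using Cons.prems by (cases n) auto
    then show ?thesis using Cons Suc by (auto simp: nths_Compl_simps)
  qed
qed simp

text \<open>Bringing the entry x from position j to the front takes j exchanges of neighbours. This
  links L_z, which puts brackets in place of an argument, with the formula for d, which puts them in
  front.\<close>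

lemma alt_list_update:
  assumes "alternating n \<omega>" "zs \<in> tup n" "j < n" "x \<in> V"
  shows "\<omega> (zs[j := x]) = (- 1) ^ j * \<omega> (x # nths zs (- {j}))"
  using assms
proof (induction zs arbitrary: n \<omega> j)
  case (Cons z zs)
  then obtain m where [simp]: "n = Suc m" and z: "z \<in> V" and zs: "zs \<in> tup m" by auto
  show ?case
  proof (cases j)
    case 0
    then show ?thesis by (simp add: nths_Compl_simps)
  next
    case (Suc k)
    then obtain l where m: "m = Suc l" using Cons.prems by (cases m) auto
    have "\<omega> (z # zs[k := x]) = (- 1) ^ k * \<omega> (z # x # nths zs (- {k}))"
      using Cons.prems z zs Suc by (intro Cons.IH[of m]) auto
    also have "\<omega> (z # x # nths zs (- {k})) = - \<omega> (x # z # nths zs (- {k}))"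
      using Cons.prems z zs Suc m by (intro alt_swap[of l] nths_Compl_in_tup) auto
    finally show ?thesis using Suc by (simp add: nths_Compl_simps)
  qed
qed simp

text \<open>L_z \<omega> supplies the action of z and, after \<open>alt_list_update\<close>, the
  brackets of z with the other arguments. The other terms come from -d i_z \<omega>: in the single
  sum the minus sign accounts for the index shift, in the double sum both indices shift and the sign
  comes from moving the bracket past z.\<close>

lemma d_eq:
  assumes "alternating q \<omega>" "zs \<in> tup (Suc q)"
  shows "d \<omega> zs = (\<Sum>i\<le>q. (- 1) ^ i * act (zs ! i) (\<omega> (nths zs (- {i})))) +
    (\<Sum>j\<le>q. \<Sum>i<j. (- 1) ^ (i + j) * \<omega> (br (zs ! i) (zs ! j) # nths zs (- {i, j})))"
  using assms
proof (induction zs arbitrary: q \<omega>)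
  case (Cons z zs)
  then have z: "z \<in> V" and zs: "zs \<in> tup q" by auto
  note \<omega> = \<open>alternating q \<omega>\<close>
  \<comment> \<open>Summing over i < q instead of i \<le> q - 1 includes q = 0, where both sums are
    empty.\<close>
  let ?S1 = "\<Sum>i<q. (- 1) ^ i * act (zs ! i) (\<omega> (z # nths zs (- {i})))"
  let ?S2 = "\<Sum>j<q. \<Sum>i<j. (- 1) ^ (i + j) * \<omega> (z # br (zs ! i) (zs ! j) # nths zs (- {i, j}))"
  have nth_V: "zs ! i \<in> V" if "i < q" for i
    using zs that by (auto simp: tup_def)
  have IH: "d (\<lambda>zs. \<omega> (z # zs)) zs = ?S1 + ?S2"
  proof (cases q)
    case 0
    then show ?thesis using zs by (simp add: tup_0)
  next
    case (Suc k)
    then show ?thesis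
      using Cons.IH[of k "\<lambda>zs. \<omega> (z # zs)"] \<omega> zs z by (simp add: lessThan_Suc_atMost)
  qed
  have upd: "(\<Sum>j<q. \<omega> (zs[j := br z (zs ! j)])) =
      (\<Sum>j<q. (- 1) ^ j * \<omega> (br z (zs ! j) # nths zs (- {j})))"
    by (intro sum.cong refl alt_list_update[OF \<omega> zs]) (auto simp: nth_V br_closed z)
  have swap: "\<omega> (br (zs ! i) (zs ! j) # z # nths zs (- {i, j})) =
      - \<omega> (z # br (zs ! i) (zs ! j) # nths zs (- {i, j}))" if "i < j" "j < q" for i j
  proof -
    obtain k where k: "q = Suc (Suc k)" using \<open>i < j\<close> \<open>j < q\<close> by (cases q; cases "q - 1") auto
    show ?thesis
      using that \<omega> zs unfolding k
      by (intro alt_swap nths_Compl2_in_tup br_closed nth_V z) (auto simp: k)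
  qed
  have "(\<Sum>i\<le>q. (- 1) ^ i * act ((z # zs) ! i) (\<omega> (nths (z # zs) (- {i})))) = act z (\<omega> zs) - ?S1"
    by (simp add: lessThan_Suc_atMost[symmetric] sum.lessThan_Suc_shift nths_Compl_simps sum_negf
        del: sum.lessThan_Suc)
  moreover have "(\<Sum>j\<le>q. \<Sum>i<j. (- 1) ^ (i + j) *
        \<omega> (br ((z # zs) ! i) ((z # zs) ! j) # nths (z # zs) (- {i, j}))) =
      (\<Sum>j<q. (\<Sum>i<j. (- 1) ^ (i + j) * \<omega> (br (zs ! i) (zs ! j) # z # nths zs (- {i, j})))
        - (- 1) ^ j * \<omega> (br z (zs ! j) # nths zs (- {j})))"
    by (simp add: lessThan_Suc_atMost[symmetric] sum.lessThan_Suc_shift nths_Compl_simps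
        del: sum.lessThan_Suc)
  moreover have "\<dots> = - ?S2 - (\<Sum>j<q. \<omega> (zs[j := br z (zs ! j)]))"
    unfolding upd sum_subtractf by (simp add: swap sum_negf)
  moreover have "lie z \<omega> zs = act z (\<omega> zs) - (\<Sum>j<q. \<omega> (zs[j := br z (zs ! j)]))"
    using zs by (simp add: lie_def tup_def)
  ultimately show ?case by (simp add: IH)
qed (simp)

end

section \<open>Smooth functions and vector fields\<close>

lemma Ck_on_Suc_imp: "Ck_on (Suc k) S f \<Longrightarrow> Ck_on k S f"
proof (induction k arbitrary: f)
  case 0
  then show ?case
    by (auto intro!: continuous_at_imp_continuous_on differentiable_imp_continuous_within)
next
  case (Suc k)
  then show ?case unfolding Ck_on.simps(2)[of "Suc k"] Ck_on.simps(2)[of k] by blast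
qed

text \<open>On an open set f and g agree near each point, so they have the same derivatives
  there.\<close>

lemma Ck_on_cong:
  assumes "open S" "\<And>x. x \<in> S \<Longrightarrow> f x = g x" "Ck_on k S f"
  shows "Ck_on k S g"
  using assms(2,3)
proof (induction k arbitrary: f g)
  case 0
  then show ?case by (simp cong: continuous_on_cong)
next
  case (Suc k)
  have der: "(g has_derivative frechet_derivative f (at x)) (at x)" if "x \<in> S" for x
    using Suc.prems that assms(1)
    by (auto simp: frechet_derivative_works intro: has_derivative_transform_within_open)
  then have eq: "frechet_derivative g (at x) = frechet_derivative f (at x)" if "x \<in> S" for x
    using frechet_derivative_at that by metis
  have "Ck_on k S (\<lambda>x. frechet_derivative g (at x) v)" for v
    by (rule Suc.IH[of "\<lambda>x. frechet_derivative f (at x) v"]) (use Suc.prems eq in auto)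
  then show ?case using der by (auto simp: differentiable_def)
qed

lemma Ck_on_const: "Ck_on k S (\<lambda>x. c)"
  by (induction k arbitrary: c) auto

text \<open>As in the next two lemmas, a calculus rule provides an explicit derivative; uniqueness
  identifies it with \<open>frechet_derivative\<close> on S, and the induction hypothesis is applied
  to the explicit form.\<close>

lemma Ck_on_bounded_linear:
  assumes "bounded_linear L" "open S" "Ck_on k S f"
  shows "Ck_on k S (\<lambda>x. L (f x))"
  using assms(3)
proof (induction k arbitrary: f)
  case 0
  then show ?case using assms(1) by (auto intro: bounded_linear.continuous_on)
next
  case (Suc k)
  have der: "((\<lambda>x. L (f x)) has_derivative (\<lambda>v. L (frechet_derivative f (at x) v))) (at x)"
    if "x \<in> S" for x
    using Suc.prems that assms(1)
    by (auto simp: frechet_derivative_works intro: bounded_linear.has_derivative)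
  have "Ck_on k S (\<lambda>x. frechet_derivative (\<lambda>x. L (f x)) (at x) v)" for v
  proof (rule Ck_on_cong[OF assms(2)])
    show "Ck_on k S (\<lambda>x. L (frechet_derivative f (at x) v))"
      using Suc by simp
  qed (simp flip: frechet_derivative_at[OF der])
  then show ?case using der by (auto simp: differentiable_def)
qed

lemma Ck_on_add:
  assumes "open S" "Ck_on k S f" "Ck_on k S g"
  shows "Ck_on k S (\<lambda>x. f x + g x)"
  using assms(2,3)
proof (induction k arbitrary: f g)
  case 0
  then show ?case by (auto intro: continuous_on_add)
next
  case (Suc k)
  have der: "((\<lambda>x. f x + g x) has_derivative
      (\<lambda>v. frechet_derivative f (at x) v + frechet_derivative g (at x) v)) (at x)" if "x \<in> S" for x
    using Suc.prems that by (intro has_derivative_add) (auto simp: frechet_derivative_works)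
  have "Ck_on k S (\<lambda>x. frechet_derivative (\<lambda>x. f x + g x) (at x) v)" for v
  proof (rule Ck_on_cong[OF assms(1)])
    show "Ck_on k S (\<lambda>x. frechet_derivative f (at x) v + frechet_derivative g (at x) v)"
      using Suc by simp
  qed (simp flip: frechet_derivative_at[OF der])
  then show ?case using der by (auto simp: differentiable_def)
qed

lemma Ck_on_mult:
  fixes f g :: "'a::real_normed_vector \<Rightarrow> real"
  assumes "open S" "Ck_on k S f" "Ck_on k S g"
  shows "Ck_on k S (\<lambda>x. f x * g x)"
  using assms(2,3)
proof (induction k arbitrary: f g)
  case 0
  then show ?case by (auto intro: continuous_on_mult)
next
  case (Suc k)
  have der: "((\<lambda>x. f x * g x) has_derivative
      (\<lambda>v. f x * frechet_derivative g (at x) v + frechet_derivative f (at x) v * g x)) (at x)"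
    if "x \<in> S" for x
    using Suc.prems that by (intro has_derivative_mult) (auto simp: frechet_derivative_works)
  have "Ck_on k S (\<lambda>x. frechet_derivative (\<lambda>x. f x * g x) (at x) v)" for v
  proof (rule Ck_on_cong[OF assms(1)])
    show "Ck_on k S (\<lambda>x. f x * frechet_derivative g (at x) v + frechet_derivative f (at x) v * g x)"
      \<comment> \<open>The factors left undifferentiated are of class C^(k+1) and have to be used
        as C^k.\<close>
      using Suc.prems by (intro Ck_on_add[OF assms(1)] Suc.IH) (auto intro: Ck_on_Suc_imp)
  qed (simp flip: frechet_derivative_at[OF der])
  then show ?case using der by (auto simp: differentiable_def)
qed

lemma smooth_on_cong:
  "open S \<Longrightarrow> (\<And>x. x \<in> S \<Longrightarrow> f x = g x) \<Longrightarrow> smooth_on S f \<Longrightarrow> smooth_on S g"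
  unfolding smooth_on_def using Ck_on_cong by blast

lemma smooth_on_const: "smooth_on S (\<lambda>x. c)"
  unfolding smooth_on_def using Ck_on_const by blast

lemma smooth_on_bounded_linear:
  "bounded_linear L \<Longrightarrow> open S \<Longrightarrow> smooth_on S f \<Longrightarrow> smooth_on S (\<lambda>x. L (f x))"
  unfolding smooth_on_def using Ck_on_bounded_linear by blast

lemma smooth_on_add: "open S \<Longrightarrow> smooth_on S f \<Longrightarrow> smooth_on S g \<Longrightarrow> smooth_on S (\<lambda>x. f x + g x)"
  unfolding smooth_on_def using Ck_on_add by blast

lemma smooth_on_mult:
  fixes f g :: "'a::real_normed_vector \<Rightarrow> real"
  shows "open S \<Longrightarrow> smooth_on S f \<Longrightarrow> smooth_on S g \<Longrightarrow> smooth_on S (\<lambda>x. f x * g x)"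
  unfolding smooth_on_def using Ck_on_mult by blast

lemma smooth_on_sum:
  assumes "open S" "\<And>i. i \<in> I \<Longrightarrow> smooth_on S (f i)"
  shows "smooth_on S (\<lambda>x. \<Sum>i\<in>I. f i x)"
  using assms(2)
  by (induction I rule: infinite_finite_induct) (auto intro: smooth_on_const smooth_on_add assms(1))

lemma smooth_on_imp_continuous_on: "smooth_on S f \<Longrightarrow> continuous_on S f"
  unfolding smooth_on_def using Ck_on.simps(1) by blast

lemma smooth_on_imp_differentiable: "smooth_on S f \<Longrightarrow> x \<in> S \<Longrightarrow> f differentiable (at x)"
  unfolding smooth_on_def using Ck_on.simps(2) by blast

lemma smooth_on_frechet_derivative:
  "smooth_on S f \<Longrightarrow> smooth_on S (\<lambda>x. frechet_derivative f (at x) v)"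
  unfolding smooth_on_def using Ck_on.simps(2) by blast

text \<open>The model space comes with a finite spanning set only, so coordinates are taken from an
  orthogonal one. The remainder y is orthogonal to the span of B, hence to itself. A zero vector in
  B does no harm, since division by 0 yields 0.\<close>

lemma inner_orthogonal_expansion:
  fixes x :: "'a::real_inner"
  assumes "finite B" "span B = UNIV" "pairwise orthogonal B"
  shows "x = (\<Sum>b\<in>B. (x \<bullet> b / (b \<bullet> b)) *\<^sub>R b)"
proof -
  define y where "y = x - (\<Sum>b\<in>B. (x \<bullet> b / (b \<bullet> b)) *\<^sub>R b)"
  have "orthogonal y c" if "c \<in> B" for c
  proof -
    have "(\<Sum>b\<in>B. (x \<bullet> b / (b \<bullet> b)) * (b \<bullet> c)) = (\<Sum>b\<in>B. if b = c then x \<bullet> c else 0)"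
      using assms(3) that by (intro sum.cong) (auto simp: pairwise_def orthogonal_def)
    then show ?thesis
      using assms(1) that by (simp add: orthogonal_def y_def inner_diff_left inner_sum_left)
  qed
  then have "orthogonal y y" using orthogonal_to_span[of y B y] assms(2) by auto
  then show ?thesis by (simp add: orthogonal_self y_def)
qed

text \<open>Smoothness speaks of derivatives in constant directions. Expanding the variable
  direction \<open>w x\<close> in an orthogonal basis gives a finite sum of smooth coefficients
  times such derivatives.\<close>

lemma smooth_on_frechet_derivative_apply:
  fixes f :: "'a::real_inner \<Rightarrow> real" and w :: "'a \<Rightarrow> 'a"
  assumes "\<exists>B::'a set. finite B \<and> span B = UNIV" "open S" "smooth_on S f" "smooth_on S w"
  shows "smooth_on S (\<lambda>x. frechet_derivative f (at x) (w x))"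
proof -
  obtain B :: "'a set" where B: "finite B" "span B = UNIV" "pairwise orthogonal B"
    using assms(1) basis_orthogonal by metis
  show ?thesis
  proof (rule smooth_on_cong[OF assms(2)])
    show "smooth_on S (\<lambda>x. \<Sum>b\<in>B. (w x \<bullet> b / (b \<bullet> b)) * frechet_derivative f (at x) b)"
    proof (intro smooth_on_sum smooth_on_mult assms(2) smooth_on_frechet_derivative assms(3))
      fix b :: 'a
      have "bounded_linear (\<lambda>v. v \<bullet> b / (b \<bullet> b))"
        by (intro bounded_linear_divide[THEN bounded_linear_compose] bounded_linear_inner_left)
      then show "smooth_on S (\<lambda>x. w x \<bullet> b / (b \<bullet> b))"
        by (rule smooth_on_bounded_linear) (use assms in auto)
    qed
  next
    fix x assume "x \<in> S"
    then interpret linear "frechet_derivative f (at x)"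
      using assms(3) by (intro linear_frechet_derivative smooth_on_imp_differentiable)
    have "frechet_derivative f (at x) (w x) =
        frechet_derivative f (at x) (\<Sum>b\<in>B. (w x \<bullet> b / (b \<bullet> b)) *\<^sub>R b)"
      using inner_orthogonal_expansion[OF B, of "w x"] by simp
    then show "(\<Sum>b\<in>B. (w x \<bullet> b / (b \<bullet> b)) * frechet_derivative f (at x) b) =
        frechet_derivative f (at x) (w x)"
      by (simp add: sum scale)
  qed
qed

section \<open>Manifold topology and smooth functions in charts\<close>

definition open_charts :: "('a, 'e::real_inner) atlas \<Rightarrow> bool" where
  "open_charts A \<longleftrightarrow> (\<forall>(U, \<phi>)\<in>A. inj_on \<phi> U \<and> open (\<phi> ` U))"

lemma open_chartsD: "open_charts A \<Longrightarrow> (U, \<phi>) \<in> A \<Longrightarrow> inj_on \<phi> U \<and> open (\<phi> ` U)"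
  by (auto simp: open_charts_def)

lemma openin_points:
  assumes "open_charts A"
  shows "openin (atlas_topology A) (points A)"
proof -
  have "points A \<inter> U = U" if "(U, \<phi>) \<in> A" for U \<phi>
    using that by (auto simp: points_def)
  then show ?thesis
    using open_chartsD[OF assms] by (subst openin_atlas_topology) auto
qed

lemma topspace_atlas_topology:
  assumes "open_charts A"
  shows "topspace (atlas_topology A) = points A"
proof -
  have "topspace (atlas_topology A) \<subseteq> points A"
    using openin_topspace[of "atlas_topology A"] open_chartsD[OF assms]
    by (subst (asm) openin_atlas_topology) auto
  then show ?thesis using openin_subset[OF openin_points[OF assms]] by auto
qed

lemma atlas_topology_space_atlas: "atlas_topology space_atlas = euclidean"
  unfolding topology_eq by (subst openin_atlas_topology) (auto simp: space_atlas_def points_def)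

text \<open>Continuity is automatic: smooth chart expressions are continuous, so every chart sends
  the preimage of an open set to an open set.\<close>

lemma smooth_map_space_atlas_iff:
  assumes "open_charts A"
  shows "smooth_map A space_atlas f \<longleftrightarrow> (\<forall>(U, \<phi>)\<in>A. smooth_on (\<phi> ` U) (f \<circ> inv_into U \<phi>))"
proof -
  have "continuous_map (atlas_topology A) euclidean f"
    if *: "\<forall>(U, \<phi>)\<in>A. smooth_on (\<phi> ` U) (f \<circ> inv_into U \<phi>)"
    unfolding continuous_map topspace_atlas_topology[OF assms]
  proof (intro conjI allI impI)
    fix W :: "'c set" assume "openin euclidean W"
    then have "open W" by simp
    have "open (\<phi> ` ({x \<in> points A. f x \<in> W} \<inter> U))" if U: "(U, \<phi>) \<in> A" for U \<phi>
    proof -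
      have "\<phi> ` ({x \<in> points A. f x \<in> W} \<inter> U) = \<phi> ` U \<inter> (f \<circ> inv_into U \<phi>) -` W"
        using U open_chartsD[OF assms U] by (auto simp: points_def intro!: imageI)
      also have "open \<dots>"
        using * U open_chartsD[OF assms U] \<open>open W\<close>
        by (intro continuous_open_preimage smooth_on_imp_continuous_on) auto
      finally show ?thesis .
    qed
    then show "openin (atlas_topology A) {x \<in> points A. f x \<in> W}"
      using open_chartsD[OF assms] by (subst openin_atlas_topology) auto
  qed auto
  then show ?thesis
    unfolding smooth_map_def atlas_topology_space_atlas
    by (auto simp: space_atlas_def comp_def)
qed

lemma smooth_functions_iff:
  assumes "open_charts A"
  shows "f \<in> smooth_functions A \<longleftrightarrow>
    (\<forall>(U, \<phi>)\<in>A. smooth_on (\<phi> ` U) (\<lambda>y. f (inv_into U \<phi> y))) \<and> (\<forall>p. p \<notin> points A \<longrightarrow> f p = 0)"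
  by (simp add: smooth_functions_def smooth_map_space_atlas_iff[OF assms] comp_def)

lemma smooth_functions_closed:
  assumes "open_charts A"
  shows "(\<lambda>p. 0) \<in> smooth_functions A"
    and "\<lbrakk>f \<in> smooth_functions A; g \<in> smooth_functions A\<rbrakk> \<Longrightarrow> (\<lambda>p. f p + g p) \<in> smooth_functions A"
    and "f \<in> smooth_functions A \<Longrightarrow> (\<lambda>p. - f p) \<in> smooth_functions A"
    and "\<lbrakk>f \<in> smooth_functions A; g \<in> smooth_functions A\<rbrakk> \<Longrightarrow> (\<lambda>p. f p * g p) \<in> smooth_functions A"
  unfolding smooth_functions_iff[OF assms]
  using open_chartsD[OF assms]
  by (fastforce intro: smooth_on_const smooth_on_add smooth_on_mult
      smooth_on_bounded_linear[OF bounded_linear_minus[OF bounded_linear_ident]])+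

lemma inv_into_Int:
  assumes "inj_on \<phi> U" "y \<in> \<phi> ` (U \<inter> W)"
  shows "inv_into (U \<inter> W) \<phi> y = inv_into U \<phi> y"
  using assms by (auto simp: inv_into_f_f inj_on_Int)

text \<open>\<open>smooth_at\<close> speaks of restricted atlases; with this their topology and
  smooth maps have the same description as those of A.\<close>

lemma open_charts_open_sub:
  assumes "open_charts A" "openin (atlas_topology A) W"
  shows "open_charts (open_sub A W)"
  using assms(2) open_chartsD[OF assms(1)]
  by (subst (asm) openin_atlas_topology)
    (fastforce simp: open_charts_def open_sub_def Int_commute inj_on_Int)+

text \<open>\<open>smooth_at\<close> gives smoothness only in charts cut down to some W, and
  \<open>inv_into\<close> changes with the domain. Near \<phi> p the two chart inverses agree, so
  the given chart can be used.\<close>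

lemma smooth_atD:
  assumes A: "open_charts A" and f: "smooth_at A p f" and U: "(U, \<phi>) \<in> A" "p \<in> U"
  shows "(f \<circ> inv_into U \<phi>) differentiable (at (\<phi> p))"
proof -
  obtain W where W: "openin (atlas_topology A) W" "p \<in> W"
    and sm: "smooth_map (open_sub A W) space_atlas f"
    using f by (auto simp: smooth_at_def)
  note inj = open_chartsD[OF A U(1), THEN conjunct1]
  have oc: "open_charts (open_sub A W)" using A W by (intro open_charts_open_sub)
  have UW: "(U \<inter> W, \<phi>) \<in> open_sub A W" using U by (force simp: open_sub_def)
  have "smooth_on (\<phi> ` (U \<inter> W)) (f \<circ> inv_into (U \<inter> W) \<phi>)"
    using sm UW unfolding smooth_map_space_atlas_iff[OF oc] by auto
  moreover have "(f \<circ> inv_into (U \<inter> W) \<phi>) x = (f \<circ> inv_into U \<phi>) x" if "x \<in> \<phi> ` (U \<inter> W)" for x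
    using inv_into_Int[OF inj that] by simp
  moreover have "open (\<phi> ` (U \<inter> W))" using open_chartsD[OF oc UW] by blast
  ultimately have "smooth_on (\<phi> ` (U \<inter> W)) (f \<circ> inv_into U \<phi>)"
    using smooth_on_cong by blast
  then show ?thesis
    using U W by (auto intro!: smooth_on_imp_differentiable)
qed

lemma smooth_functions_smooth_at:
  assumes "open_charts A" "f \<in> smooth_functions A" "p \<in> points A"
  shows "smooth_at A p f"
proof -
  \<comment> \<open>The whole manifold serves as the neighbourhood of p; restricting the charts to
    it changes nothing.\<close>
  have "(\<lambda>(U, \<phi>). (U \<inter> points A, \<phi>)) ` A = (\<lambda>c. c) ` A"
    by (rule image_cong) (auto simp: points_def)
  then have "open_sub A (points A) = A"
    by (simp add: open_sub_def)
  then show ?thesis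
    using assms openin_points[OF assms(1)] by (auto simp: smooth_at_def smooth_functions_def)
qed

section \<open>Tangent vectors in charts\<close>

lemma smooth_manifold_open_charts: "smooth_manifold A \<Longrightarrow> open_charts A"
  by (simp add: smooth_manifold_def open_charts_def)

lemma smooth_manifold_transition:
  assumes "smooth_manifold A" "(U, \<phi>) \<in> A" "(V, \<psi>) \<in> A"
  shows "open (\<phi> ` (U \<inter> V)) \<and> smooth_on (\<phi> ` (U \<inter> V)) (\<psi> \<circ> inv_into U \<phi>)"
  using assms by (fastforce simp: smooth_manifold_def)

lemma openin_chart_domain:
  assumes A: "smooth_manifold A" and U: "(U, \<phi>) \<in> A"
  shows "openin (atlas_topology A) U"
proof -
  have "U \<subseteq> points A" using U by (auto simp: points_def)
  then show ?thesis
    using smooth_manifold_transition[OF A _ U] open_chartsD[OF smooth_manifold_open_charts[OF A]]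
    by (subst openin_atlas_topology) (auto simp: Int_commute)
qed

text \<open>In another chart a coordinate of \<phi> is a coordinate of a transition map. This is
  needed because \<open>velocity\<close> is 0 by convention on functions that are not smooth near
  the point.\<close>

lemma smooth_at_coordinate:
  assumes A: "smooth_manifold A" and U: "(U, \<phi>) \<in> A" "p \<in> U"
  shows "smooth_at A p (\<lambda>q. \<phi> q \<bullet> b)"
proof -
  note A' = smooth_manifold_open_charts[OF A]
  note oU = openin_chart_domain[OF A U(1)]
  have oc: "open_charts (open_sub A U)" using A' oU by (rule open_charts_open_sub)
  have "smooth_on (\<psi> ` (V \<inter> U)) ((\<lambda>q. \<phi> q \<bullet> b) \<circ> inv_into (V \<inter> U) \<psi>)" if V: "(V, \<psi>) \<in> A" for V \<psi>
  proof (rule smooth_on_cong)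
    show "open (\<psi> ` (V \<inter> U))" using smooth_manifold_transition[OF A V U(1)] by simp
    show "smooth_on (\<psi> ` (V \<inter> U)) (\<lambda>y. (\<phi> \<circ> inv_into V \<psi>) y \<bullet> b)"
      by (rule smooth_on_bounded_linear[OF bounded_linear_inner_left])
        (use smooth_manifold_transition[OF A V U(1)] in blast)+
  qed (use open_chartsD[OF A' V] in \<open>simp add: inv_into_Int\<close>)
  then have "smooth_map (open_sub A U) space_atlas (\<lambda>q. \<phi> q \<bullet> b)"
    unfolding smooth_map_space_atlas_iff[OF oc] by (auto simp: open_sub_def)
  then show ?thesis using oU U by (auto simp: smooth_at_def)
qed

text \<open>In a chart the velocity of \<gamma> is the directional derivative along w = (\<phi> o
  \<gamma>)'(0), by the chain rule. On the coordinate functions it returns w, so w is the vector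
  selected in \<open>tangent_atlas\<close>; the first and third conclusions determine v from
  w.\<close>

lemma tangent_vector_chart:
  assumes A: "smooth_manifold A" and U: "(U, \<phi>) \<in> A" "p \<in> U" and v: "v \<in> tangent_space A p"
  obtains w where "\<And>f. smooth_at A p f \<Longrightarrow> v f = frechet_derivative (f \<circ> inv_into U \<phi>) (at (\<phi> p)) w"
    and "\<And>b. v (\<lambda>q. \<phi> q \<bullet> b) = w \<bullet> b"
    and "\<And>f. \<not> smooth_at A p f \<Longrightarrow> v f = 0"
proof -
  note A' = smooth_manifold_open_charts[OF A]
  note inj = open_chartsD[OF A' U(1), THEN conjunct1]
  obtain \<gamma> \<epsilon> where \<epsilon>: "\<epsilon> > 0" and sm: "smooth_map (open_sub space_atlas {-\<epsilon><..<\<epsilon>}) A \<gamma>"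
    and \<gamma>0: "\<gamma> 0 = p" and v_eq: "v = velocity A \<gamma>"
    using v by (auto simp: tangent_space_def)
  define I where "I = {-\<epsilon><..<\<epsilon>}"
  \<comment> \<open>The times at which \<gamma> stays in the chart domain. By continuity J is a
    neighbourhood of 0, which suffices for derivatives at 0.\<close>
  define J where "J = {t \<in> I. \<gamma> t \<in> U}"
  have sub: "open_sub space_atlas I = {(I, \<lambda>x. x)}"
    by (simp add: open_sub_def space_atlas_def)
  have ocI: "open_charts {(I, \<lambda>x. x)}" by (simp add: open_charts_def I_def)
  have pts: "points {(I, \<lambda>x::real. x)} = I" by (simp add: points_def)
  have "openin (atlas_topology {(I, \<lambda>x. x)}) J"
    using sm openin_chart_domain[OF A U(1)]
    unfolding I_def[symmetric] sub smooth_map_def continuous_map topspace_atlas_topology[OF ocI] pts J_def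
    by blast
  then have "open ((\<lambda>x. x) ` (J \<inter> I))"
    by (subst (asm) openin_atlas_topology) auto
  moreover have "J \<inter> I = J" by (auto simp: J_def)
  ultimately have openJ: "open J" by simp
  have J0: "0 \<in> J" using \<epsilon> \<gamma>0 U by (simp add: J_def I_def)
  have "smooth_on ((\<lambda>x. x) ` (I \<inter> \<gamma> -` U)) (\<phi> \<circ> \<gamma> \<circ> inv_into I (\<lambda>x. x))"
    using sm U(1) unfolding I_def[symmetric] sub smooth_map_def by auto
  moreover have "(\<lambda>x. x) ` (I \<inter> \<gamma> -` U) = J" by (auto simp: J_def)
  ultimately have "smooth_on J (\<phi> \<circ> \<gamma> \<circ> inv_into I (\<lambda>x. x))" by simp
  then have "smooth_on J (\<phi> \<circ> \<gamma>)"
    by (rule smooth_on_cong[OF openJ, rotated]) (auto simp: J_def inv_into_f_f[of "\<lambda>x. x", simplified])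
  then have "(\<phi> \<circ> \<gamma>) differentiable (at 0)"
    using J0 by (rule smooth_on_imp_differentiable)
  then have der: "((\<phi> \<circ> \<gamma>) has_derivative frechet_derivative (\<phi> \<circ> \<gamma>) (at 0)) (at 0)"
    by (simp only: frechet_derivative_works)
  define w where "w = frechet_derivative (\<phi> \<circ> \<gamma>) (at 0) 1"
  have "frechet_derivative (\<phi> \<circ> \<gamma>) (at 0) = (\<lambda>t. t *\<^sub>R w)"
  proof
    fix t show "frechet_derivative (\<phi> \<circ> \<gamma>) (at 0) t = t *\<^sub>R w"
      using linear_scale[OF has_derivative_linear[OF der], of t 1] unfolding w_def by simp
  qed
  with der have w: "((\<phi> \<circ> \<gamma>) has_derivative (\<lambda>t. t *\<^sub>R w)) (at 0)" by simp
  \<comment> \<open>Stated for any derivative D, since it is used for functions smooth near p and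
    for the linear coordinates.\<close>
  have deriv: "deriv (\<lambda>t. f (\<gamma> t)) 0 = D w"
    if "((f \<circ> inv_into U \<phi>) has_derivative D) (at (\<phi> p))" for f D
  proof -
    have "((f \<circ> inv_into U \<phi>) \<circ> (\<phi> \<circ> \<gamma>) has_derivative D \<circ> (\<lambda>t. t *\<^sub>R w)) (at 0)"
      using w that \<gamma>0 by (intro diff_chain_at) auto
    then have "((\<lambda>t. f (\<gamma> t)) has_derivative D \<circ> (\<lambda>t. t *\<^sub>R w)) (at 0)"
      by (rule has_derivative_transform_within_open[OF _ openJ J0]) (auto simp: J_def inv_into_f_f inj)
    moreover have "D \<circ> (\<lambda>t. t *\<^sub>R w) = (*) (D w)"
      using linear_scale[OF has_derivative_linear[OF that]] by auto
    ultimately have "((\<lambda>t. f (\<gamma> t)) has_field_derivative D w) (at 0)"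
      by (simp add: has_field_derivative_def)
    then show ?thesis by (rule DERIV_imp_deriv)
  qed
  have "v f = frechet_derivative (f \<circ> inv_into U \<phi>) (at (\<phi> p)) w" if "smooth_at A p f" for f
    using deriv smooth_atD[OF A' that U] that
    by (simp add: v_eq velocity_def \<gamma>0 frechet_derivative_works)
  moreover have "v (\<lambda>q. \<phi> q \<bullet> b) = w \<bullet> b" for b
  proof -
    have "((\<lambda>y. y \<bullet> b) has_derivative (\<lambda>y. y \<bullet> b)) (at (\<phi> p))"
      by (intro bounded_linear_imp_has_derivative bounded_linear_inner_left)
    then have "((\<lambda>q. \<phi> q \<bullet> b) \<circ> inv_into U \<phi> has_derivative (\<lambda>y. y \<bullet> b)) (at (\<phi> p))"
      by (rule has_derivative_transform_within_open[of _ _ _ _ "\<phi> ` U"])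
        (use open_chartsD[OF A' U(1)] U in \<open>auto simp: f_inv_into_f\<close>)
    then show ?thesis
      using deriv smooth_at_coordinate[OF A U, of b] by (simp add: v_eq velocity_def \<gamma>0)
  qed
  moreover have "v f = 0" if "\<not> smooth_at A p f" for f
    using that by (simp add: v_eq velocity_def \<gamma>0)
  ultimately show thesis using that by blast
qed

lemma the_coordinate_vector:
  fixes w :: "'e::real_inner"
  assumes "\<And>b. g b = w \<bullet> b"
  shows "(THE w. \<forall>b. g b = w \<bullet> b) = w"
proof (rule the_equality)
  fix w' assume "\<forall>b. g b = w' \<bullet> b"
  then have "\<forall>b. w' \<bullet> b = w \<bullet> b" using assms by simp
  then show "w' = w" by (simp only: vector_eq_rdot)
qed (use assms in simp)

text \<open>A tangent vector is recovered from its coordinate vector: it is a directional derivative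
  on functions smooth near p and 0 on all others. Injectivity is what
  \<open>openin_atlas_topology\<close> asks of the tangent atlas.\<close>

lemma inj_on_tangent_chart:
  assumes A: "smooth_manifold A" and U: "(U, \<phi>) \<in> A"
  shows "inj_on (\<lambda>(p, v). (\<phi> p, THE w. \<forall>b. v (\<lambda>q. \<phi> q \<bullet> b) = w \<bullet> b)) (Sigma U (tangent_space A))"
proof (rule inj_onI, clarsimp)
  fix p v q v'
  assume p: "p \<in> U" "v \<in> tangent_space A p" and q: "q \<in> U" "v' \<in> tangent_space A q"
    and "\<phi> p = \<phi> q"
    and eq: "(THE w. \<forall>b. v (\<lambda>q. \<phi> q \<bullet> b) = w \<bullet> b) = (THE w. \<forall>b. v' (\<lambda>q. \<phi> q \<bullet> b) = w \<bullet> b)"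
  then have [simp]: "q = p"
    using open_chartsD[OF smooth_manifold_open_charts[OF A] U] by (auto simp: inj_on_def)
  obtain w where w: "\<And>f. smooth_at A p f \<Longrightarrow> v f = frechet_derivative (f \<circ> inv_into U \<phi>) (at (\<phi> p)) w"
    "\<And>b. v (\<lambda>q. \<phi> q \<bullet> b) = w \<bullet> b" "\<And>f. \<not> smooth_at A p f \<Longrightarrow> v f = 0"
    using tangent_vector_chart[OF A U p] by metis
  obtain w' where w': "\<And>f. smooth_at A p f \<Longrightarrow> v' f = frechet_derivative (f \<circ> inv_into U \<phi>) (at (\<phi> p)) w'"
    "\<And>b. v' (\<lambda>q. \<phi> q \<bullet> b) = w' \<bullet> b" "\<And>f. \<not> smooth_at A p f \<Longrightarrow> v' f = 0"
    using tangent_vector_chart[OF A U p(1) q(2)[simplified]] by metis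
  have "w = w'" using eq the_coordinate_vector[OF w(2)] the_coordinate_vector[OF w'(2)] by simp
  then have "v f = v' f" for f using w w' by (cases "smooth_at A p f") simp_all
  then show "p = q \<and> v = v'" by auto
qed

text \<open>Membership in the tangent space is not a clause of \<open>sections\<close>; it follows
  from continuity, since a continuous map takes its values in the topological space, whose points
  are covered by tangent charts.\<close>

lemma tangent_section_tangent_space:
  assumes A: "smooth_manifold A" and X: "X \<in> sections (tangent_bundle A)" and p: "p \<in> points A"
  shows "fst (X p) = p" "snd (X p) \<in> tangent_space A p"
proof -
  show *: "fst (X p) = p" using X p by (auto simp: sections_def tangent_bundle_def)
  have "X p \<in> topspace (atlas_topology (tangent_atlas A))"
    using X p topspace_atlas_topology[OF smooth_manifold_open_charts[OF A]]
    by (auto simp: sections_def tangent_bundle_def smooth_map_def continuous_map)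
  moreover have "topspace (atlas_topology (tangent_atlas A)) \<subseteq> points (tangent_atlas A)"
    using openin_topspace[of "atlas_topology (tangent_atlas A)"] inj_on_tangent_chart[OF A]
    by (subst (asm) openin_atlas_topology) (auto simp: tangent_atlas_def)
  ultimately show "snd (X p) \<in> tangent_space A p"
    using * by (auto simp: points_def tangent_atlas_def)
qed

section \<open>Vector fields as derivations of the smooth functions\<close>

lemma vf_act_closed:
  assumes A: "smooth_manifold A" and X: "X \<in> sections (tangent_bundle A)"
    and f: "f \<in> smooth_functions A"
  shows "vf_act A X f \<in> smooth_functions A"
proof -
  note A' = smooth_manifold_open_charts[OF A]
  have "smooth_on (\<phi> ` U) (\<lambda>y. vf_act A X f (inv_into U \<phi> y))" if U: "(U, \<phi>) \<in> A" for U \<phi>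
  proof -
    note oU = open_chartsD[OF A' U]
    define \<Psi> where "\<Psi> = (\<lambda>(p, v). (\<phi> p, THE w. \<forall>b. v (\<lambda>q. \<phi> q \<bullet> b) = w \<bullet> b))"
    have chart: "(Sigma U (tangent_space A), \<Psi>) \<in> tangent_atlas A"
      using U by (force simp: tangent_atlas_def \<Psi>_def)
    \<comment> \<open>Over U the field X stays in the induced tangent chart, so its coordinate
      expression is smooth on all of the chart image.\<close>
    have XU: "U \<inter> X -` Sigma U (tangent_space A) = U"
    proof -
      have "X p \<in> Sigma U (tangent_space A)" if "p \<in> U" for p
        using tangent_section_tangent_space[OF A X, of p] that U
        by (cases "X p") (auto simp: points_def)
      then show ?thesis by auto
    qed
    have "smooth_on (\<phi> ` U) (\<Psi> \<circ> X \<circ> inv_into U \<phi>)"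
      using X U chart XU unfolding sections_def tangent_bundle_def smooth_map_def
      by fastforce
    then have w: "smooth_on (\<phi> ` U) (\<lambda>y. snd ((\<Psi> \<circ> X \<circ> inv_into U \<phi>) y))"
      using oU by (intro smooth_on_bounded_linear[OF bounded_linear_snd]) blast+
    show ?thesis
    proof (rule smooth_on_cong)
      show "smooth_on (\<phi> ` U) (\<lambda>y. frechet_derivative (f \<circ> inv_into U \<phi>) (at y)
          (snd ((\<Psi> \<circ> X \<circ> inv_into U \<phi>) y)))"
      proof (rule smooth_on_frechet_derivative_apply[OF _ _ _ w])
        show "smooth_on (\<phi> ` U) (f \<circ> inv_into U \<phi>)"
          using f U by (auto simp: smooth_functions_iff[OF A'] comp_def)
      qed (use A oU in \<open>auto simp: smooth_manifold_def\<close>)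
      fix y assume "y \<in> \<phi> ` U"
      then obtain p where p: "p \<in> U" "y = \<phi> p" by auto
      then have inv: "inv_into U \<phi> y = p" using oU by auto
      have pA: "p \<in> points A" using p U by (auto simp: points_def)
      obtain w where w: "\<And>f. smooth_at A p f \<Longrightarrow>
          snd (X p) f = frechet_derivative (f \<circ> inv_into U \<phi>) (at (\<phi> p)) w"
        "\<And>b. snd (X p) (\<lambda>q. \<phi> q \<bullet> b) = w \<bullet> b"
        using tangent_vector_chart[OF A U p(1) tangent_section_tangent_space(2)[OF A X pA]] by metis
      have "snd (\<Psi> (X p)) = w"
        using the_coordinate_vector[OF w(2)] by (simp add: \<Psi>_def case_prod_beta)
      then show "frechet_derivative (f \<circ> inv_into U \<phi>) (at y) (snd ((\<Psi> \<circ> X \<circ> inv_into U \<phi>) y)) =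
          vf_act A X f (inv_into U \<phi> y)"
        using w(1)[OF smooth_functions_smooth_at[OF A' f pA]] pA inv p(2)
        by (simp add: vf_act_def)
    qed (use oU in simp)
  qed
  then show ?thesis unfolding smooth_functions_iff[OF A'] by (auto simp: vf_act_def)
qed

text \<open>At a fixed point the field is a directional derivative in a chart, so these are the sum
  and product rules; off the manifold all terms are 0.\<close>

lemma vf_act_derivation:
  assumes A: "smooth_manifold A" and X: "X \<in> sections (tangent_bundle A)"
    and f: "f \<in> smooth_functions A" and g: "g \<in> smooth_functions A"
  shows "vf_act A X (\<lambda>p. f p + g p) p = vf_act A X f p + vf_act A X g p"
    and "vf_act A X (\<lambda>p. f p * g p) p = vf_act A X f p * g p + f p * vf_act A X g p"
proof -
  note A' = smooth_manifold_open_charts[OF A]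
  have "vf_act A X (\<lambda>p. f p + g p) p = vf_act A X f p + vf_act A X g p \<and>
    vf_act A X (\<lambda>p. f p * g p) p = vf_act A X f p * g p + f p * vf_act A X g p"
  proof (cases "p \<in> points A")
    case p: True
    then obtain U \<phi> where U: "(U, \<phi>) \<in> A" "p \<in> U" by (auto simp: points_def)
    note inj = open_chartsD[OF A' U(1), THEN conjunct1]
    obtain w where w: "\<And>f. smooth_at A p f \<Longrightarrow>
        snd (X p) f = frechet_derivative (f \<circ> inv_into U \<phi>) (at (\<phi> p)) w"
      using tangent_vector_chart[OF A U tangent_section_tangent_space(2)[OF A X p]] by metis
    let ?D = "\<lambda>f. frechet_derivative (f \<circ> inv_into U \<phi>) (at (\<phi> p))"
    have sm: "smooth_at A p h" if "h \<in> smooth_functions A" for h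
      using smooth_functions_smooth_at[OF A' that p] .
    have Xh: "vf_act A X h p = ?D h w" if "h \<in> smooth_functions A" for h
      using w[OF sm[OF that]] p by (simp add: vf_act_def)
    have der: "((\<lambda>y. h (inv_into U \<phi> y)) has_derivative ?D h) (at (\<phi> p))" if "h \<in> smooth_functions A" for h
      using smooth_atD[OF A' sm[OF that] U] by (simp add: frechet_derivative_works comp_def)
    have "?D (\<lambda>p. f p + g p) = (\<lambda>v. ?D f v + ?D g v)"
      using has_derivative_add[OF der[OF f] der[OF g]]
      by (simp add: comp_def flip: frechet_derivative_at)
    moreover have "?D (\<lambda>p. f p * g p) = (\<lambda>v. f p * ?D g v + ?D f v * g p)"
      using has_derivative_mult[OF der[OF f] der[OF g]] U inj
      by (simp add: comp_def flip: frechet_derivative_at)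
    ultimately show ?thesis
      using Xh f g smooth_functions_closed(2,4)[OF A' f g] by (simp add: add.commute)
  qed (simp add: vf_act_def)
  then show "vf_act A X (\<lambda>p. f p + g p) p = vf_act A X f p + vf_act A X g p"
    and "vf_act A X (\<lambda>p. f p * g p) p = vf_act A X f p * g p + f p * vf_act A X g p" by auto
qed

lemma vf_act_sec_add:
  "vf_act A (sec_add (tangent_bundle A) X Y) f p = vf_act A X f p + vf_act A Y f p"
  by (simp add: vf_act_def sec_add_def tangent_bundle_def case_prod_beta)

text \<open>A global smooth function passes the guard \<open>smooth_at\<close> in
  \<open>vf_bracket\<close> at every point.\<close>

lemma vf_act_vf_bracket:
  assumes "smooth_manifold A" "f \<in> smooth_functions A"
  shows "vf_act A (vf_bracket A X Y) f p = vf_act A X (vf_act A Y f) p - vf_act A Y (vf_act A X f) p"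
  using smooth_functions_smooth_at[OF smooth_manifold_open_charts[OF assms(1)] assms(2)]
  by (simp add: vf_act_def vf_bracket_def)

section \<open>Forms on a generalized Lie algebroid\<close>

context real_lie_algebra
begin

lemma add_right_cancel:
  assumes "u \<in> lcarrier L" "v \<in> lcarrier L" "w \<in> lcarrier L" "ladd L u w = ladd L v w"
  shows "u = v"
proof -
  obtain w' where w': "w' \<in> lcarrier L" "ladd L w w' = lzero L" using add_inverse assms by blast
  have "ladd L (ladd L u w) w' = ladd L (ladd L v w) w'" using assms by simp
  then show ?thesis using assms(1-3) w' by (metis add_assoc add_zero)
qed

lemma bracket_skew:
  assumes [simp]: "u \<in> lcarrier L" "v \<in> lcarrier L"
  shows "ladd L (lbracket L u v) (lbracket L v u) = lzero L"
proof -
  note [simp] = bracket_closed add_closed zero_closed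
  have "lzero L = lbracket L (ladd L u v) (ladd L u v)" by (simp add: bracket_self)
  also have "\<dots> = ladd L (ladd L (lzero L) (lbracket L u v)) (ladd L (lbracket L v u) (lzero L))"
    by (subst bracket_add_left) (simp_all add: bracket_add_right bracket_self)
  also have "\<dots> = ladd L (lbracket L u v) (lbracket L v u)"
    by (simp add: add_commute[of "lzero L"] add_zero)
  finally show ?thesis by simp
qed

lemma bracket_zero_right:
  assumes [simp]: "u \<in> lcarrier L"
  shows "lbracket L u (lzero L) = lzero L"
proof (rule add_right_cancel)
  note [simp] = bracket_closed zero_closed
  have "ladd L (lbracket L u (lzero L)) (lbracket L u (lzero L)) = lbracket L u (lzero L)"
    by (simp add: add_zero flip: bracket_add_right)
  then show "ladd L (lbracket L u (lzero L)) (lbracket L u (lzero L)) =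
      ladd L (lzero L) (lbracket L u (lzero L))"
    by (simp add: add_commute[of "lzero L"] add_zero)
qed (simp_all add: bracket_closed zero_closed)

text \<open>By skew-symmetry p' and q' are the negatives of p and q. Both r and p + q add up to zero
  with q' and p', so they are equal by cancellation.\<close>

lemma jacobi_derivation:
  assumes [simp]: "u \<in> lcarrier L" "v \<in> lcarrier L" "w \<in> lcarrier L"
  shows "ladd L (lbracket L (lbracket L u v) w) (lbracket L v (lbracket L u w)) =
    lbracket L u (lbracket L v w)"
proof -
  note [simp] = bracket_closed zero_closed add_closed
  define p where "p = lbracket L (lbracket L u v) w"
  define p' where "p' = lbracket L w (lbracket L u v)"
  define q where "q = lbracket L v (lbracket L u w)"
  define q' where "q' = lbracket L v (lbracket L w u)"
  define r where "r = lbracket L u (lbracket L v w)"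
  have cl [simp]: "p \<in> lcarrier L" "p' \<in> lcarrier L" "q \<in> lcarrier L" "q' \<in> lcarrier L" "r \<in> lcarrier L"
    by (simp_all add: p_def p'_def q_def q'_def r_def)
  have p: "ladd L p p' = lzero L"
    unfolding p_def p'_def by (rule bracket_skew) simp_all
  have q: "ladd L q q' = lzero L"
    unfolding q_def q'_def by (simp add: bracket_skew bracket_zero_right flip: bracket_add_right)
  have "ladd L (ladd L r q') p' = lzero L"
    unfolding r_def p'_def q'_def by (rule jacobi) simp_all
  moreover have "ladd L (ladd L (ladd L p q) q') p' = lzero L"
    using p q by (simp add: add_assoc add_zero add_commute[of _ "lzero L"])
  ultimately have "ladd L p q = r"
    by (metis add_right_cancel add_closed cl)
  then show ?thesis by (simp add: p_def q_def r_def)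
qed

end

text \<open>This and the next two facts evaluate operations of the function ring at a point, where
  the operators of the theorem are defined.\<close>

lemma sum_fun_apply: "(\<Sum>i\<in>I. f i) p = (\<Sum>i\<in>I. f i p)"
  by (induction I rule: infinite_finite_induct) auto

lemma power_fun_apply: "(f ^ k) p = f p ^ k"
  by (induction k) auto

lemma of_int_fun_apply: "of_int k p = of_int k"
  by (cases k rule: int_cases2) auto

section \<open>Transfer to the algebroid\<close>

context generalized_lie_algebroid
begin

abbreviation "E \<equiv> bundleF G"
abbreviation "S \<equiv> smooth_functions (manN G)"

lemma smooth_manifold_N: "smooth_manifold (manN G)"
  using vector_bundle_F by (simp add: vector_bundle_def)

lemma anchor_sections: "u \<in> sections E \<Longrightarrow> anchor G u \<in> sections (tangent_bundle (manN G))"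
  using anchor_hom by (auto simp: lie_algebra_hom_def sections_lie_algebra_def)

text \<open>Geometry enters here: vector fields are derivations by the computations in charts, and
  the anchor, being a morphism of Lie algebras, turns brackets of sections into commutators of
  derivations.\<close>

sublocale lie_module "sections E" "sec_add E" "sec_zero E" "bracket G" S
  "\<lambda>u. vf_act (manN G) (anchor G u)"
proof
  interpret L: real_lie_algebra "sections_lie_algebra E (bracket G)" by (rule lie_algebra_F)
  note L_simps = sections_lie_algebra_def lie_algebra.simps
  show "sec_add E u v \<in> sections E" if "u \<in> sections E" "v \<in> sections E" for u v
    using L.add_closed[unfolded L_simps] that by blast
  show zero: "sec_zero E \<in> sections E"
    using L.zero_closed[unfolded L_simps] by blast
  show "sec_add E (sec_zero E) (sec_zero E) = sec_zero E"
    using L.add_zero[unfolded L_simps] zero by blast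
  show "bracket G u v \<in> sections E" if "u \<in> sections E" "v \<in> sections E" for u v
    using L.bracket_closed[unfolded L_simps] that by blast
  show "bracket G (sec_add E u v) w = sec_add E (bracket G u w) (bracket G v w)"
    if "u \<in> sections E" "v \<in> sections E" "w \<in> sections E" for u v w
    using L.bracket_add_left[unfolded L_simps] that by blast
  show "bracket G u (sec_add E v w) = sec_add E (bracket G u v) (bracket G u w)"
    if "u \<in> sections E" "v \<in> sections E" "w \<in> sections E" for u v w
    using L.bracket_add_right[unfolded L_simps] that by blast
  show "bracket G u u = sec_zero E" if "u \<in> sections E" for u
    using L.bracket_self[unfolded L_simps] that by blast
  show "sec_add E (bracket G (bracket G u v) w) (bracket G v (bracket G u w)) =
      bracket G u (bracket G v w)"
    if "u \<in> sections E" "v \<in> sections E" "w \<in> sections E" for u v w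
    using L.jacobi_derivation[unfolded L_simps] that by blast
next
  note ring = smooth_functions_closed[OF smooth_manifold_open_charts[OF smooth_manifold_N]]
  show "0 \<in> S" using ring(1) by (simp add: zero_fun_def)
  show "f + g \<in> S" if "f \<in> S" "g \<in> S" for f g
    using ring(2)[OF that] by (simp add: plus_fun_def)
  show "- f \<in> S" if "f \<in> S" for f
    using ring(3)[OF that] by (simp add: fun_Compl_def)
  show "f * g \<in> S" if "f \<in> S" "g \<in> S" for f g
    using ring(4)[OF that] by (simp add: times_fun_def)
next
  show "vf_act (manN G) (anchor G u) f \<in> S" if "u \<in> sections E" "f \<in> S" for u f
    using vf_act_closed[OF smooth_manifold_N anchor_sections] that by blast
  show "vf_act (manN G) (anchor G u) (f + g) =
      vf_act (manN G) (anchor G u) f + vf_act (manN G) (anchor G u) g"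
    if "u \<in> sections E" "f \<in> S" "g \<in> S" for u f g
    using vf_act_derivation(1)[OF smooth_manifold_N anchor_sections that(2,3)] that(1)
    by (auto simp: plus_fun_def)
  show "vf_act (manN G) (anchor G u) (f * g) =
      vf_act (manN G) (anchor G u) f * g + f * vf_act (manN G) (anchor G u) g"
    if "u \<in> sections E" "f \<in> S" "g \<in> S" for u f g
    using vf_act_derivation(2)[OF smooth_manifold_N anchor_sections that(2,3)] that(1)
    by (auto simp: plus_fun_def times_fun_def)
  show "vf_act (manN G) (anchor G (sec_add E u v)) f =
      vf_act (manN G) (anchor G u) f + vf_act (manN G) (anchor G v) f"
    if "u \<in> sections E" "v \<in> sections E" for u v f
  proof -
    have "anchor G (sec_add E u v) = sec_add (tangent_bundle (manN G)) (anchor G u) (anchor G v)"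
      using anchor_hom that by (simp add: lie_algebra_hom_def sections_lie_algebra_def)
    then show ?thesis by (auto simp: vf_act_sec_add)
  qed
  show "vf_act (manN G) (anchor G (bracket G u v)) f =
      vf_act (manN G) (anchor G u) (vf_act (manN G) (anchor G v) f) -
      vf_act (manN G) (anchor G v) (vf_act (manN G) (anchor G u) f)"
    if "u \<in> sections E" "v \<in> sections E" "f \<in> S" for u v f
  proof -
    have "anchor G (bracket G u v) = vf_bracket (manN G) (anchor G u) (anchor G v)"
      using anchor_hom that by (simp add: lie_algebra_hom_def sections_lie_algebra_def)
    then show ?thesis by (auto simp: vf_act_vf_bracket[OF smooth_manifold_N that(3)])
  qed
qed

lemma tuples_eq_tup: "tuples E q = tup q"
  by (simp add: tuples_def tup_def)

lemma contract_in_forms: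
  assumes \<omega>: "\<omega> \<in> forms E (Suc q)" and z: "z \<in> sections E"
  shows "(\<lambda>zs. \<omega> (z # zs)) \<in> forms E q"
proof -
  have t: "z # zs \<in> tuples E (Suc q) \<longleftrightarrow> zs \<in> tuples E q" for zs
    using z by (simp add: tuples_eq_tup)
  show ?thesis
    unfolding forms_def mem_Collect_eq
  proof (intro conjI ballI allI impI)
    fix zs i j assume "zs \<in> tuples E q" "i < j \<and> j < q \<and> zs ! i = zs ! j"
    then have "z # zs \<in> tuples E (Suc q)" "Suc i < Suc j \<and> Suc j < Suc q \<and> (z # zs) ! Suc i = (z # zs) ! Suc j"
      using t by auto
    then show "\<omega> (z # zs) = (\<lambda>p. 0)"
      using \<omega> unfolding forms_def by blast
  next
    fix zs i u v assume zs: "zs \<in> tuples E q" "i < q" and uv: "u \<in> sections E" "v \<in> sections E"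
    then have "z # zs \<in> tuples E (Suc q)" "Suc i < Suc q" using t by auto
    then have "\<omega> ((z # zs)[Suc i := sec_add E u v]) =
        (\<lambda>p. \<omega> ((z # zs)[Suc i := u]) p + \<omega> ((z # zs)[Suc i := v]) p)"
      using \<omega> uv unfolding forms_def by blast
    then show "\<omega> (z # zs[i := sec_add E u v]) = (\<lambda>p. \<omega> (z # zs[i := u]) p + \<omega> (z # zs[i := v]) p)"
      by simp
  next
    fix zs i u f assume zs: "zs \<in> tuples E q" "i < q" and uf: "u \<in> sections E" "f \<in> S"
    then have "z # zs \<in> tuples E (Suc q)" "Suc i < Suc q" using t by auto
    then have "\<omega> ((z # zs)[Suc i := sec_scale E f u]) = (\<lambda>p. f p * \<omega> ((z # zs)[Suc i := u]) p)"
      using \<omega> uf unfolding forms_def by blast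
    then show "\<omega> (z # zs[i := sec_scale E f u]) = (\<lambda>p. f p * \<omega> (z # zs[i := u]) p)"
      by simp
  qed (use \<omega> t in \<open>auto simp: forms_def\<close>)
qed

text \<open>\<open>alternating\<close> tests additivity in the first argument and repetition in the
  first two, then passes to contractions. \<open>contract_in_forms\<close> supplies these, with all
  positions shifted by one.\<close>

lemma forms_alt: "\<omega> \<in> forms E q \<Longrightarrow> alternating q \<omega>"
proof (induction q arbitrary: \<omega>)
  case 0
  then show ?case by (auto simp: forms_def tuples_eq_tup)
next
  case (Suc q)
  show ?case
    unfolding alternating.simps
  proof (intro conjI ballI allI impI)
    fix u v zs assume uv: "u \<in> sections E" "v \<in> sections E" and "zs \<in> tup q"
    then have "u # zs \<in> tuples E (Suc q)" "0 < Suc q" by (auto simp: tuples_eq_tup)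
    then have "\<omega> ((u # zs)[0 := sec_add E u v]) = (\<lambda>p. \<omega> ((u # zs)[0 := u]) p + \<omega> ((u # zs)[0 := v]) p)"
      using Suc.prems uv unfolding forms_def by blast
    then show "\<omega> (sec_add E u v # zs) = \<omega> (u # zs) + \<omega> (v # zs)" by (auto simp: plus_fun_def)
  next
    fix z zs assume z: "z \<in> sections E" "z # zs \<in> tup q"
    then have "z # z # zs \<in> tuples E (Suc q)" "0 < (1::nat) \<and> 1 < Suc q \<and> (z # z # zs) ! 0 = (z # z # zs) ! 1"
      by (auto simp: tuples_eq_tup)
    then show "\<omega> (z # z # zs) = 0"
      using Suc.prems unfolding forms_def zero_fun_def by blast
  qed (use Suc contract_in_forms in blast)
qed

lemma wedge_eq: "wedge E q r \<omega> \<theta> zs = (if zs \<in> tup (q + r) then wedge_rec q r \<omega> \<theta> zs else 0)"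
proof (cases "zs \<in> tup (q + r)")
  case True
  then have "length zs = q + r" by (simp add: tup_def)
  with True show ?thesis
    by (intro ext) (simp add: wedge_def tuples_eq_tup wedge_rec_shuffle_perms sum_fun_apply of_int_fun_apply)
qed (auto simp: wedge_def tuples_eq_tup)

text \<open>Alternation is assumed because the recursion leaves brackets at inner positions, while
  \<open>ext_diff\<close> has them in front.\<close>

lemma ext_diff_eq:
  assumes "alternating q \<omega>"
  shows "ext_diff G q \<omega> zs = (if zs \<in> tup (Suc q) then d \<omega> zs else 0)"
  by (intro ext) (simp add: ext_diff_def tuples_eq_tup d_eq[OF assms] sum_fun_apply power_fun_apply)

lemma lie_deriv_eq: "lie_deriv G q z \<omega> zs = (if zs \<in> tup q then lie z \<omega> zs else 0)"
  by (intro ext) (simp add: lie_deriv_def tuples_eq_tup lie_def sum_fun_apply tup_def)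

lemma ext_diff_wedge:
  assumes \<omega>: "\<omega> \<in> forms E q" and \<theta>: "\<theta> \<in> forms E r"
  shows "ext_diff G (q + r) (wedge E q r \<omega> \<theta>) zs p =
    wedge E (Suc q) r (ext_diff G q \<omega>) \<theta> zs p + (- 1) ^ q * wedge E q (Suc r) \<omega> (ext_diff G r \<theta>) zs p"
proof -
  note alts = forms_alt[OF \<omega>] forms_alt[OF \<theta>]
  \<comment> \<open>The cut-off does not disturb alternation, which \<open>ext_diff_eq\<close>
    requires of the form being differentiated.\<close>
  have "alternating (q + r) (wedge E q r \<omega> \<theta>)"
    by (rule alt_cong[OF _ alt_wedge_rec[OF alts refl]]) (simp add: wedge_eq)
  note D = ext_diff_eq[OF this] ext_diff_eq[OF alts(1)] ext_diff_eq[OF alts(2)]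
  show ?thesis
  proof (cases "zs \<in> tup (Suc (q + r))")
    case True
    have "d (wedge E q r \<omega> \<theta>) zs = d (wedge_rec q r \<omega> \<theta>) zs"
      by (rule d_cong[OF _ True]) (simp add: wedge_eq)
    also have "\<dots> = wedge_rec (Suc q) r (d \<omega>) \<theta> zs + (- 1) ^ q * wedge_rec q (Suc r) \<omega> (d \<theta>) zs"
      by (rule d_wedge_rec[OF alts True])
    also have "wedge_rec (Suc q) r (d \<omega>) \<theta> zs = wedge_rec (Suc q) r (ext_diff G q \<omega>) \<theta> zs"
      by (rule wedge_rec_cong) (use True in \<open>auto simp: D\<close>)
    also have "wedge_rec q (Suc r) \<omega> (d \<theta>) zs = wedge_rec q (Suc r) \<omega> (ext_diff G r \<theta>) zs"
      by (rule wedge_rec_cong) (use True in \<open>auto simp: D\<close>)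
    finally have "d (wedge E q r \<omega> \<theta>) zs p = (wedge_rec (Suc q) r (ext_diff G q \<omega>) \<theta> zs +
        (- 1) ^ q * wedge_rec q (Suc r) \<omega> (ext_diff G r \<theta>) zs) p" by (rule fun_cong)
    \<comment> \<open>The two products on the right are cut off at degrees written differently; both
      equal the length of zs.\<close>
    moreover have "zs \<in> tup (Suc q + r)" "zs \<in> tup (q + Suc r)" using True by simp_all
    ultimately show ?thesis
      unfolding D(1) wedge_eq using True by (simp only: if_True plus_fun_apply times_fun_apply power_fun_apply) simp
  qed (simp add: D(1) wedge_eq)
qed

lemma lie_deriv_ext_diff:
  assumes z: "z \<in> sections E" and \<omega>: "\<omega> \<in> forms E q"
  shows "lie_deriv G (Suc q) z (ext_diff G q \<omega>) zs = ext_diff G q (lie_deriv G q z \<omega>) zs"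
proof -
  note alternating = forms_alt[OF \<omega>]
  have "alternating q (lie_deriv G q z \<omega>)"
    by (rule alt_cong[OF _ alt_lie[OF alternating z]]) (simp add: lie_deriv_eq)
  note D = ext_diff_eq[OF this] ext_diff_eq[OF alternating]
  show ?thesis
  proof (cases "zs \<in> tup (Suc q)")
    case True
    have "lie z (ext_diff G q \<omega>) zs = lie z (d \<omega>) zs"
      by (rule lie_cong[OF _ z True]) (simp add: D)
    also have "\<dots> = d (lie z \<omega>) zs" by (rule lie_d[OF alternating z True])
    also have "\<dots> = d (lie_deriv G q z \<omega>) zs"
      by (rule d_cong[OF _ True]) (simp add: lie_deriv_eq)
    finally show ?thesis using True by (simp add: D(1) lie_deriv_eq)
  qed (simp add: D(1) lie_deriv_eq)
qed

lemma ext_diff_ext_diff: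
  assumes \<omega>: "\<omega> \<in> forms E q"
  shows "ext_diff G (Suc q) (ext_diff G q \<omega>) zs = 0"
proof -
  note alternating = forms_alt[OF \<omega>]
  have "alternating (Suc q) (ext_diff G q \<omega>)"
    by (rule alt_cong[OF _ alt_d[OF alternating]]) (simp add: ext_diff_eq[OF alternating])
  note D = ext_diff_eq[OF this] ext_diff_eq[OF alternating]
  have "d (ext_diff G q \<omega>) zs = d (d \<omega>) zs" if "zs \<in> tup (Suc (Suc q))"
    by (rule d_cong[OF _ that]) (simp add: D)
  then show ?thesis by (simp add: D(1) d_d[OF alternating])
qed

end

theorem theorem4p8:
  fixes G :: "('f, 'n, 'e::real_inner, 'k::real_inner, 'm, 'd::real_inner) gla_data"
  assumes "generalized_lie_algebroid G"
  shows "(\<forall>q r. \<forall>\<omega>\<in>forms (bundleF G) q. \<forall>\<theta>\<in>forms (bundleF G) r.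
            ext_diff G (q + r) (wedge (bundleF G) q r \<omega> \<theta>) =
              (\<lambda>zs p. wedge (bundleF G) (Suc q) r (ext_diff G q \<omega>) \<theta> zs p
                 + (- 1) ^ q * wedge (bundleF G) q (Suc r) \<omega> (ext_diff G r \<theta>) zs p)) \<and>
         (\<forall>z\<in>sections (bundleF G). \<forall>q. \<forall>\<omega>\<in>forms (bundleF G) q.
            lie_deriv G (Suc q) z (ext_diff G q \<omega>) = ext_diff G q (lie_deriv G q z \<omega>)) \<and>
         (\<forall>q. \<forall>\<omega>\<in>forms (bundleF G) q.
            ext_diff G (Suc q) (ext_diff G q \<omega>) = (\<lambda>zs p. 0))"
proof -
  interpret generalized_lie_algebroid G by (fact assms)
  show ?thesis
    using ext_diff_wedge lie_deriv_ext_diff ext_diff_ext_diff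
    by (simp add: fun_eq_iff)
qed

end
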